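(* Let $\Sigma, Z$ be sets and $f: Z\times\Sigma^n\to\{0,1\}$ a partial function. Suppose there exists a $(\rho_0,\rho_1)$-robust relaxed local algorithm $M$ for computing $f$ with query complexity $\ell = O(1)$ and $\rho_0,\rho_1 = \Omega(1)$, and let $V \subseteq \Sigma^n$ be the valid inputs of $M$. Then there exists a sample-based relaxed local algorithm $N$ for $f$ with sample complexity $n^{1-1/O(\ell^2\log^2\ell)}$ with the same valid inputs $V$.
   Context: A relaxed local algorithm $M$ for computing a partial function $f: Z\times\Sigma^n\to\{0,1\}$ with error rate $\sigma$ (default $1/3$) and valid input set $V$ (a subset of the domain of $f$) receives explicit $z\in Z$ and query access to $x\in\Sigma^n$, makes at most $\ell$ queries, may output a special symbol $\bot$, and satisfies: $\Pr[M^x(z)=f(z,x)]\ge 1-\sigma$ for $x\in V$, and $\Pr[M^x(z)\in\{f(z,x),\bot\}]\ge 1-\sigma$ for inputs $x\notin V$ in the domain. With $B_\rho(x)$ the set of strings at relative Hamming distance at most $\rho$ from $x$, $M$ is $\rho$-robust at $x$ if $\Pr[M^w(z)\in\{f(z,x),\bot\}]\ge 1-\sigma$ for all $w\in B_\rho(x)$; it is $(\rho_0,\rho_1)$-robust if it is $\rho_b$-robust at every $x$ with $f(z,x)=b$. A sample-based algorithm queries each coordinate independently with some fixed probability (possibly capping the number of samples); its sample complexity is the number of coordinates sampled. Asymptotics are as $n\to\infty$.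
   Formalization: The alphabet Σ is assumed finite and fixed as n → ∞ (Z stays an arbitrary set); for infinite Σ the claim fails, since one symbol can encode a whole claimed codeword that a 2-query robust algorithm spot-checks but that o(n) random samples miss. *)

theory Defs
  imports "HOL-Probability.Probability"
begin

definition strings :: "'s set \<Rightarrow> nat \<Rightarrow> 's list set" where
  "strings A n = {x. set x \<subseteq> A \<and> length x = n}"

definition hamming_ball :: "'s set \<Rightarrow> nat \<Rightarrow> real \<Rightarrow> 's list \<Rightarrow> 's list set" where
  "hamming_ball A n \<rho> x =
     {w \<in> strings A n. real (card {i. i < n \<and> w ! i \<noteq> x ! i}) \<le> \<rho> * real n}"

text \<open>
  A deterministic adaptive query algorithm is a decision tree; a randomized algorithm with explicit
  input in \<open>'z\<close> is a family of distributions over decision trees, so that all coins are tossed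
  before the first query. Queries are charged along every path, also when a coordinate is repeated.

  The output type is \<open>bool option\<close>, where \<open>None\<close> is the special symbol \<open>\<bottom>\<close>. This is unrelated
  to \<open>None\<close> as a value of the partial function \<open>f\<close>, which means "undefined"; the definitions
  below compare outputs with \<open>f (z, x)\<close> only where \<open>f\<close> is defined.
\<close>

datatype ('s, 'b) qtree = Output 'b | Query nat "'s \<Rightarrow> ('s, 'b) qtree"

primrec run :: "('s, 'b) qtree \<Rightarrow> 's list \<Rightarrow> 'b" where
  "run (Output b) x = b"
| "run (Query i k) x = run (k (x ! i)) x"

primrec queries_at_most :: "'s set \<Rightarrow> nat \<Rightarrow> ('s, 'b) qtree \<Rightarrow> nat \<Rightarrow> bool" where
  "queries_at_most A n (Output b) = (\<lambda>l. True)"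
| "queries_at_most A n (Query i k) =
     (\<lambda>l. i < n \<and> 0 < l \<and> (\<forall>a\<in>A. queries_at_most A n (k a) (l - 1)))"

type_synonym ('z, 's) algorithm = "'z \<Rightarrow> ('s, bool option) qtree pmf"

definition output_prob :: "('z, 's) algorithm \<Rightarrow> 'z \<Rightarrow> 's list \<Rightarrow> bool option set \<Rightarrow> real" where
  "output_prob M z x B = measure_pmf.prob (M z) {t. run t x \<in> B}"

definition relaxed_local_algorithm ::
  "'s set \<Rightarrow> nat \<Rightarrow> 'z set \<Rightarrow> ('z \<times> 's list \<rightharpoonup> bool) \<Rightarrow> 's list set \<Rightarrow> real \<Rightarrow> nat
     \<Rightarrow> ('z, 's) algorithm \<Rightarrow> bool" where
  "relaxed_local_algorithm A n Z f V \<sigma> l M \<longleftrightarrow>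
     (\<forall>z\<in>Z. \<forall>t\<in>set_pmf (M z). queries_at_most A n t l) \<and>
     (\<forall>(z, x)\<in>dom f. x \<in> V \<longrightarrow> output_prob M z x {f (z, x)} \<ge> 1 - \<sigma>) \<and>
     (\<forall>(z, x)\<in>dom f. x \<notin> V \<longrightarrow> output_prob M z x {f (z, x), None} \<ge> 1 - \<sigma>)"

definition robust_at ::
  "'s set \<Rightarrow> nat \<Rightarrow> ('z \<times> 's list \<rightharpoonup> bool) \<Rightarrow> real \<Rightarrow> ('z, 's) algorithm \<Rightarrow> real \<Rightarrow> 'z \<Rightarrow> 's list \<Rightarrow> bool" where
  "robust_at A n f \<sigma> M \<rho> z x \<longleftrightarrow>
     (\<forall>w\<in>hamming_ball A n \<rho> x. output_prob M z w {f (z, x), None} \<ge> 1 - \<sigma>)"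

definition robust ::
  "'s set \<Rightarrow> nat \<Rightarrow> ('z \<times> 's list \<rightharpoonup> bool) \<Rightarrow> real \<Rightarrow> ('z, 's) algorithm \<Rightarrow> real \<Rightarrow> real \<Rightarrow> bool" where
  "robust A n f \<sigma> M \<rho>0 \<rho>1 \<longleftrightarrow>
     (\<forall>z x. f (z, x) = Some False \<longrightarrow> robust_at A n f \<sigma> M \<rho>0 z x) \<and>
     (\<forall>z x. f (z, x) = Some True \<longrightarrow> robust_at A n f \<sigma> M \<rho>1 z x)"

definition sample_set :: "nat \<Rightarrow> real \<Rightarrow> nat set pmf" where
  "sample_set n p =
     map_pmf (\<lambda>b. {i. i < n \<and> b i}) (Pi_pmf {..<n} False (\<lambda>_. bernoulli_pmf p))"

primrec query_list :: "nat list \<Rightarrow> (nat \<rightharpoonup> 's) \<Rightarrow> ((nat \<rightharpoonup> 's) \<Rightarrow> 'b) \<Rightarrow> ('s, 'b) qtree" where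
  "query_list [] v d = Output (d v)"
| "query_list (i # js) v d = Query i (\<lambda>a. query_list js (v(i \<mapsto> a)) d)"

text \<open>
  A sample-based algorithm with sample complexity \<open>q\<close> draws a set \<open>S\<close> of coordinates, each with
  the same probability \<open>p\<close> independently. If \<open>S\<close> has more than \<open>q\<close> elements it queries nothing and
  outputs \<open>\<bottom>\<close>; otherwise it queries exactly \<open>S\<close> and applies a decision rule to the sampled part of
  the input. The rule may be randomized and may depend on \<open>z\<close> and \<open>S\<close>; \<open>p\<close> may not. There is no
  cap when \<open>q \<ge> n\<close>.
\<close>

definition sample_based :: "nat \<Rightarrow> nat \<Rightarrow> ('z, 's) algorithm \<Rightarrow> bool" where
  "sample_based n q N \<longleftrightarrow>
     (\<exists>p D. 0 \<le> p \<and> p \<le> 1 \<and>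
        (\<forall>z. N z =
           bind_pmf (sample_set n p) (\<lambda>S.
             if card S \<le> q
             then map_pmf (query_list (sorted_list_of_set S) Map.empty) (D z S)
             else return_pmf (Output None))))"

end

theory Submission
  imports Defs
begin

text \<open>
  Give each coordinate the weight with which it occurs in the (repeated) decision tree of \<open>M\<close>, and cut
  the weights at the thresholds \<open>\<tau> j = n powr (- j / (q + 1))\<close>, where \<open>q\<close> is the number of queries.
  A set of at most \<open>q\<close> queries misses one of the \<open>q + 1\<close> intervals \<open>[\<tau> (j + 1), \<tau> j)\<close>. On this level
  its coordinates are either in the kernel of the \<open>O(1 / \<tau> j)\<close> coordinates of weight at least \<open>\<tau> j\<close>,
  or have weight less than \<open>\<tau> (j + 1)\<close>. The algorithm \<open>N\<close> tries all contents of the kernel and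
  estimates from the sample the probability that \<open>M\<close> would output \<open>b\<close> on this level. It votes for \<open>b\<close>
  if one of the estimates is large. With the true contents, some level has a large share of the correct
  answers. All other contents give inputs in the robustness ball, where wrong answers are rare. By
  the bounded difference inequality an estimate deviates with probability at most
  \<open>exp (- c * p ^ (2 * q) / \<tau> (j + 1))\<close>. For \<open>p = n powr (- 1 / (4 * (q + 1)\<^sup>2))\<close> this beats the number
  \<open>exp (O (1 / \<tau> j))\<close> of kernel contents.
\<close>

section \<open>Concentration for random subsets\<close>

lemma integrable_pmf_indicator: "integrable (measure_pmf R) (indicator B :: _ \<Rightarrow> real)"
  by (intro measure_pmf.integrable_const_bound[where B = 1]) (auto simp: indicator_def)

section \<open>Random subsets and inclusion probabilities\<close>

definition random_subset :: "nat set \<Rightarrow> real \<Rightarrow> nat set pmf" where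
  "random_subset I p = map_pmf (\<lambda>b. {i \<in> I. b i}) (Pi_pmf I False (\<lambda>_. bernoulli_pmf p))"

lemma sample_set_eq_random_subset: "sample_set n p = random_subset {..<n} p"
  by (simp add: sample_set_def random_subset_def)

lemma set_random_subset: "set_pmf (random_subset I p) \<subseteq> Pow I"
  by (auto simp: random_subset_def)

lemma finite_set_random_subset: "finite I \<Longrightarrow> finite (set_pmf (random_subset I p))"
  using set_random_subset finite_Pow_iff finite_subset by metis

lemma random_subset_empty: "random_subset {} p = return_pmf {}"
  by (simp add: random_subset_def)

lemma random_subset_insert:
  assumes "finite I" "x \<notin> I"
  shows "random_subset (insert x I) p =
    bind_pmf (bernoulli_pmf p)
      (\<lambda>y. map_pmf (\<lambda>S. if y then insert x S else S) (random_subset I p))"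
proof -
  have "{i \<in> insert x I. (f(x := y)) i} = (if y then insert x {i \<in> I. f i} else {i \<in> I. f i})"
    for f y using assms by auto
  then show ?thesis
    unfolding random_subset_def Pi_pmf_insert'[OF assms]
    by (simp add: map_bind_pmf pmf.map_comp o_def map_pmf_def[symmetric] bind_return_pmf
        flip: map_pmf_def)
qed

text \<open>Conditioning on whether \<open>x\<close> is sampled. This recursion drives the
  inductions over the coordinates below.\<close>

lemma expectation_random_subset_insert:
  assumes "finite I" "x \<notin> I" "0 \<le> p" "p \<le> 1"
  shows "measure_pmf.expectation (random_subset (insert x I) p) h =
    p * measure_pmf.expectation (random_subset I p) (\<lambda>S. h (insert x S))
      + (1 - p) * measure_pmf.expectation (random_subset I p) (h :: nat set \<Rightarrow> real)"
  unfolding random_subset_insert[OF assms(1,2)]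
  using assms(3,4) finite_set_random_subset[OF assms(1), of p]
  by (subst pmf_expectation_bind[where A = UNIV]) (auto simp: UNIV_bool)

lemma prob_subset_random_subset:
  assumes "finite I" "0 \<le> p" "p \<le> 1" "T \<subseteq> I"
  shows "measure_pmf.expectation (random_subset I p) (\<lambda>S. if T \<subseteq> S then 1 else 0) = p ^ card T"
  using assms(1,4)
proof (induction I arbitrary: T rule: finite_induct)
  case empty
  then show ?case by (simp add: random_subset_empty)
next
  case (insert x I)
  let ?E = "measure_pmf.expectation (random_subset I p) :: (nat set \<Rightarrow> real) \<Rightarrow> real"
  have *: "T \<subseteq> insert x S \<longleftrightarrow> T - {x} \<subseteq> S" for S by auto
  have IH: "?E (\<lambda>S. if T \<subseteq> insert x S then 1 else 0) = p ^ card (T - {x})"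
    unfolding * using insert.IH[of "T - {x}"] insert.prems by blast
  show ?case
  proof (cases "x \<in> T")
    case True
    have "?E (\<lambda>S. if T \<subseteq> S then 1 else 0) = ?E (\<lambda>S. 0)"
      using True insert.hyps set_random_subset[of I p]
      by (intro integral_cong_AE) (auto simp: AE_measure_pmf_iff)
    moreover have "card T = Suc (card (T - {x}))"
      using True insert by (metis card_Suc_Diff1 finite_insert finite_subset)
    ultimately show ?thesis
      using IH by (simp add: expectation_random_subset_insert insert.hyps assms)
  next
    case False
    then show ?thesis using IH insert.IH[of T] insert.prems
      by (simp add: expectation_random_subset_insert insert.hyps assms subset_insert algebra_simps)
  qed
qed

section \<open>The bounded difference inequality\<close>

text \<open>Hoeffding's lemma for a variable with two values. After factoring out
  \<open>exp b\<close>, the logarithm of the remaining moment is bounded by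
  \<open>Hoeffdings_lemma_aux\<close> with \<open>h = a - b\<close>, for \<open>b \<le> a\<close>.
  The other case exchanges the two values together with \<open>p\<close> and
  \<open>1 - p\<close>.\<close>

lemma Hoeffding_two_point:
  fixes a b p :: real
  assumes "0 \<le> p" "p \<le> 1"
  shows "p * exp a + (1 - p) * exp b \<le> exp (p * a + (1 - p) * b + (a - b)\<^sup>2 / 8)"
proof -
  have main: "p * exp a + (1 - p) * exp b \<le> exp (p * a + (1 - p) * b + (a - b)\<^sup>2 / 8)"
    if "0 \<le> p" "p \<le> 1" "b \<le> a" for p a b :: real
  proof -
    define h where "h = a - b"
    have pos: "0 < 1 + p * (exp h - 1)"
      using that by (intro add_pos_nonneg mult_nonneg_nonneg) (auto simp: h_def)
    have "p * exp a + (1 - p) * exp b = exp b * (1 + p * (exp h - 1))"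
      by (simp add: h_def exp_diff field_simps)
    also have "\<dots> = exp (b + ln (1 + p * (exp h - 1)))"
      using pos by (simp add: exp_add)
    also have "\<dots> \<le> exp (b + (h * p + h\<^sup>2 / 8))"
    proof -
      have "- h * p + ln (1 + p * (exp h - 1)) \<le> h\<^sup>2 / 8"
        using that by (intro Hoeffdings_lemma_aux) (auto simp: h_def)
      then show ?thesis by simp
    qed
    also have "b + (h * p + h\<^sup>2 / 8) = p * a + (1 - p) * b + (a - b)\<^sup>2 / 8"
      by (simp add: h_def algebra_simps)
    finally show ?thesis .
  qed
  show ?thesis
  proof (cases "b \<le> a")
    case False
    then show ?thesis using main[of "1 - p" a b] assms
      by (simp add: power2_commute[of a b] algebra_simps)
  qed (use main assms in blast)
qed

text \<open>Induction over the coordinates takes the place of a martingale. Given the status of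
  \<open>x\<close>, the two conditional means differ by at most \<open>c x\<close>, so the two-point
  bound adds \<open>(c x)\<^sup>2 / 8\<close> to the exponent. The differences are bounded for every
  set \<open>S\<close>, not only for subsets of \<open>I\<close>, so that the induction hypothesis
  also applies to \<open>h (insert x S)\<close>.\<close>

lemma exp_moment_bounded_differences:
  fixes h :: "nat set \<Rightarrow> real"
  assumes "finite I" "0 \<le> p" "p \<le> 1"
    and "\<And>i S. i \<in> I \<Longrightarrow> \<bar>h (insert i S) - h S\<bar> \<le> c i"
  shows "measure_pmf.expectation (random_subset I p) (\<lambda>S. exp (h S))
    \<le> exp (measure_pmf.expectation (random_subset I p) h + (\<Sum>i\<in>I. (c i)\<^sup>2) / 8)"
  using assms(1,4)
proof (induction I arbitrary: h rule: finite_induct)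
  case empty
  then show ?case by (simp add: random_subset_empty)
next
  case (insert x I)
  let ?E = "measure_pmf.expectation (random_subset I p) :: (nat set \<Rightarrow> real) \<Rightarrow> real"
  define a b s where "a = ?E (\<lambda>S. h (insert x S))" and "b = ?E h" and "s = (\<Sum>i\<in>I. (c i)\<^sup>2) / 8"
  have int: "integrable (random_subset I p) g" for g :: "nat set \<Rightarrow> real"
    by (intro integrable_measure_pmf_finite finite_set_random_subset insert)
  have 1: "?E (\<lambda>S. exp (h (insert x S))) \<le> exp (a + s)"
    unfolding a_def s_def using insert.prems
    by (intro insert.IH) (metis insert_commute insertCI)
  have 2: "?E (\<lambda>S. exp (h S)) \<le> exp (b + s)"
    unfolding b_def s_def using insert.prems by (intro insert.IH) auto
  have "\<bar>a - b\<bar> \<le> c x"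
  proof -
    have "a - b = ?E (\<lambda>S. h (insert x S) - h S)"
      by (simp add: a_def b_def int)
    also have "\<bar>\<dots>\<bar> \<le> ?E (\<lambda>S. \<bar>h (insert x S) - h S\<bar>)"
      by (rule integral_abs_bound)
    also have "\<dots> \<le> ?E (\<lambda>S. c x)"
      using insert.prems by (intro integral_mono int) auto
    finally show ?thesis by simp
  qed
  then have sq: "(a - b)\<^sup>2 \<le> (c x)\<^sup>2" by (metis abs_ge_zero power2_abs power_mono)
  have "measure_pmf.expectation (random_subset (insert x I) p) (\<lambda>S. exp (h S))
     \<le> p * exp (a + s) + (1 - p) * exp (b + s)"
    using 1 2 assms(2,3)
    by (simp add: expectation_random_subset_insert insert.hyps add_mono mult_left_mono)
  also have "\<dots> = exp s * (p * exp a + (1 - p) * exp b)"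
    by (simp add: exp_add algebra_simps)
  also have "\<dots> \<le> exp s * exp (p * a + (1 - p) * b + (a - b)\<^sup>2 / 8)"
    by (intro mult_left_mono Hoeffding_two_point assms) auto
  also have "\<dots> \<le> exp s * exp (p * a + (1 - p) * b + (c x)\<^sup>2 / 8)"
    using sq by simp
  also have "\<dots> = exp (measure_pmf.expectation (random_subset (insert x I) p) h
      + (\<Sum>i\<in>insert x I. (c i)\<^sup>2) / 8)"
    using insert.hyps assms(2,3)
    by (simp add: expectation_random_subset_insert a_def b_def s_def add_divide_distrib
        flip: exp_add)
  finally show ?case .
qed

text \<open>McDiarmid's inequality, by Markov's inequality for \<open>exp (t * h S)\<close>. The sum
  of squares enters through a positive upper bound \<open>v\<close>, so that the quotient makes
  sense even if all \<open>c i\<close> vanish.\<close>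

lemma bounded_differences_upper_tail:
  fixes h :: "nat set \<Rightarrow> real"
  assumes "finite I" "0 \<le> p" "p \<le> 1"
    and diff: "\<And>i S. i \<in> I \<Longrightarrow> \<bar>h (insert i S) - h S\<bar> \<le> c i"
    and c: "(\<Sum>i\<in>I. (c i)\<^sup>2) \<le> v" and "0 < v" "0 \<le> \<delta>"
  shows "measure_pmf.prob (random_subset I p)
      {S. measure_pmf.expectation (random_subset I p) h + \<delta> \<le> h S} \<le> exp (- 2 * \<delta>\<^sup>2 / v)"
proof -
  let ?R = "random_subset I p"
  let ?E = "measure_pmf.expectation ?R :: (nat set \<Rightarrow> real) \<Rightarrow> real"
  \<comment> \<open>This \<open>t\<close> minimises the exponent
    \<open>- t * \<delta> + t\<^sup>2 * v / 8\<close> reached at the end.\<close>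
  define m t where "m = ?E h" and "t = 4 * \<delta> / v"
  have t: "0 \<le> t" using assms by (simp add: t_def)
  have int: "integrable ?R g" for g :: "nat set \<Rightarrow> real"
    by (intro integrable_measure_pmf_finite finite_set_random_subset assms)
  have "measure_pmf.prob ?R {S. m + \<delta> \<le> h S} = ?E (indicator {S. m + \<delta> \<le> h S})"
    by simp
  also have "\<dots> \<le> ?E (\<lambda>S. exp (- t * (m + \<delta>)) * exp (t * h S))"
  proof (intro integral_mono int)
    fix S
    show "indicator {S. m + \<delta> \<le> h S} S \<le> exp (- t * (m + \<delta>)) * exp (t * h S)"
      using t by (auto simp: indicator_def mult_left_mono simp flip: exp_add)
  qed
  also have "\<dots> = exp (- t * (m + \<delta>)) * ?E (\<lambda>S. exp (t * h S))"
    by simp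
  also have "?E (\<lambda>S. exp (t * h S)) \<le> exp (?E (\<lambda>S. t * h S) + (\<Sum>i\<in>I. (t * c i)\<^sup>2) / 8)"
  proof (intro exp_moment_bounded_differences assms)
    fix i S assume "i \<in> I"
    have "\<bar>t * h (insert i S) - t * h S\<bar> = t * \<bar>h (insert i S) - h S\<bar>"
      using t by (simp add: abs_mult flip: right_diff_distrib)
    then show "\<bar>t * h (insert i S) - t * h S\<bar> \<le> t * c i"
      using diff[OF \<open>i \<in> I\<close>] t by (simp add: mult_left_mono)
  qed
  also have "\<dots> = exp (t * m + t\<^sup>2 * (\<Sum>i\<in>I. (c i)\<^sup>2) / 8)"
    by (simp add: m_def power_mult_distrib sum_distrib_left)
  also have "\<dots> \<le> exp (t * m + t\<^sup>2 * v / 8)"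
    using c by (simp add: mult_left_mono)
  also have "exp (- t * (m + \<delta>)) * \<dots> = exp (- t * \<delta> + t\<^sup>2 * v / 8)"
    by (simp add: algebra_simps flip: exp_add)
  also have "- t * \<delta> + t\<^sup>2 * v / 8 = - 2 * \<delta>\<^sup>2 / v"
    using \<open>0 < v\<close> by (simp add: t_def field_simps power2_eq_square)
  finally show ?thesis by (simp add: m_def)
qed

lemma bounded_differences_lower_tail:
  fixes h :: "nat set \<Rightarrow> real"
  assumes "finite I" "0 \<le> p" "p \<le> 1"
    and "\<And>i S. i \<in> I \<Longrightarrow> \<bar>h (insert i S) - h S\<bar> \<le> c i"
    and "(\<Sum>i\<in>I. (c i)\<^sup>2) \<le> v" "0 < v" "0 \<le> \<delta>"
  shows "measure_pmf.prob (random_subset I p)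
      {S. h S \<le> measure_pmf.expectation (random_subset I p) h - \<delta>} \<le> exp (- 2 * \<delta>\<^sup>2 / v)"
proof -
  have eq: "{S. h S \<le> m - \<delta>} = {S. - m + \<delta> \<le> - h S}" for m by auto
  show ?thesis unfolding eq
    using bounded_differences_upper_tail[of I p "\<lambda>S. - h S" c v \<delta>] assms
    by (simp add: abs_minus_commute)
qed

section \<open>The size of a random subset\<close>

lemma expectation_card_random_subset:
  assumes "finite I" "0 \<le> p" "p \<le> 1"
  shows "measure_pmf.expectation (random_subset I p) (\<lambda>S. real (card S)) = p * real (card I)"
proof -
  let ?E = "measure_pmf.expectation (random_subset I p) :: (nat set \<Rightarrow> real) \<Rightarrow> real"
  have "real (card S) = (\<Sum>i\<in>I. if {i} \<subseteq> S then 1 else 0)" if "S \<subseteq> I" for S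
    using that assms(1) by (simp add: sum.If_cases Int_absorb1 flip: Collect_conj_eq)
  then have "?E (\<lambda>S. real (card S)) = ?E (\<lambda>S. \<Sum>i\<in>I. if {i} \<subseteq> S then 1 else 0)"
    using set_random_subset[of I p] by (intro integral_cong_AE) (auto simp: AE_measure_pmf_iff)
  also have "\<dots> = (\<Sum>i\<in>I. ?E (\<lambda>S. if {i} \<subseteq> S then 1 else 0))"
    by (intro Bochner_Integration.integral_sum integrable_measure_pmf_finite
        finite_set_random_subset assms)
  also have "\<dots> = (\<Sum>i\<in>I. p)"
  proof (intro sum.cong refl)
    fix i assume "i \<in> I"
    then show "?E (\<lambda>S. if {i} \<subseteq> S then 1 else 0) = p"
      using prob_subset_random_subset[of I p "{i}"] assms by simp
  qed
  finally show ?thesis by simp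
qed

text \<open>Markov's inequality is strong enough for the cap on the sample, because the expected
  size will be smaller than the cap by a factor that is a power of \<open>n\<close>.\<close>

lemma card_random_subset_tail:
  assumes "finite I" "0 \<le> p" "p \<le> 1" "0 < u"
  shows "measure_pmf.prob (random_subset I p) {S. u \<le> real (card S)} \<le> p * real (card I) / u"
  using integral_Markov_inequality_measure[where M = "random_subset I p" and A = UNIV
      and u = "\<lambda>S. real (card S)" and c = u] assms
    finite_set_random_subset[of I p]
  by (simp add: integrable_measure_pmf_finite expectation_card_random_subset)

section \<open>Estimates from a random sample\<close>

text \<open>A random test \<open>r\<close> abstracts a tuple of decision trees: \<open>Q r x\<close>
  is what it queries on \<open>x\<close>, and \<open>U r\<close> is what it might query on any
  input. Weights are computed from \<open>U\<close>, so that they, and hence the kernels, do not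
  depend on the unknown input. \<open>Q_cong\<close> and \<open>acc_cong\<close> express that an
  adaptive test depends on its input only through the answers it has seen.\<close>

locale test_family =
  fixes A :: "'s set" and n q :: nat and W :: real
    and R :: "'r pmf" and U :: "'r \<Rightarrow> nat set" and Q :: "'r \<Rightarrow> 's list \<Rightarrow> nat set"
    and acc :: "bool \<Rightarrow> 'r \<Rightarrow> 's list \<Rightarrow> bool"
  assumes W_pos: "0 < W"
    and U_subset: "r \<in> set_pmf R \<Longrightarrow> U r \<subseteq> {..<n}"
    and card_U: "r \<in> set_pmf R \<Longrightarrow> real (card (U r)) \<le> W"
    and Q_subset: "r \<in> set_pmf R \<Longrightarrow> x \<in> strings A n \<Longrightarrow> Q r x \<subseteq> U r"
    and card_Q: "r \<in> set_pmf R \<Longrightarrow> x \<in> strings A n \<Longrightarrow> card (Q r x) \<le> q"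
    and Q_cong: "(\<And>i. i \<in> Q r x \<Longrightarrow> x ! i = y ! i) \<Longrightarrow> Q r y = Q r x"
    and acc_cong: "(\<And>i. i \<in> Q r x \<Longrightarrow> x ! i = y ! i) \<Longrightarrow> acc b r y = acc b r x"
begin

definition weight :: "nat \<Rightarrow> real" where
  "weight i = measure_pmf.prob R {r. i \<in> U r}"

definition kernel :: "real \<Rightarrow> nat set" where
  "kernel \<tau> = {i. i < n \<and> \<tau> \<le> weight i}"

definition avoids :: "real \<Rightarrow> real \<Rightarrow> nat set \<Rightarrow> bool" where
  "avoids \<tau> \<tau>' T \<longleftrightarrow> (\<forall>i\<in>T. \<not> (\<tau>' \<le> weight i \<and> weight i < \<tau>))"

text \<open>
  The factor \<open>1 / p ^ card _\<close> compensates for the probability that the queries outside the kernel are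
  sampled, so the estimate is unbiased.
\<close>

definition estimate :: "real \<Rightarrow> real \<Rightarrow> real \<Rightarrow> bool \<Rightarrow> nat set \<Rightarrow> 's list \<Rightarrow> real" where
  "estimate \<tau> \<tau>' p b S x = measure_pmf.expectation R (\<lambda>r.
     if acc b r x \<and> avoids \<tau> \<tau>' (Q r x) \<and> Q r x - kernel \<tau> \<subseteq> S
     then 1 / p ^ card (Q r x - kernel \<tau>) else 0)"

lemma weight_nonneg: "0 \<le> weight i"
  by (simp add: weight_def)

section \<open>Total weight and size of the kernel\<close>

text \<open>By linearity, the total weight is the expected size of \<open>U r\<close>.\<close>

lemma sum_weight_le: "(\<Sum>i<n. weight i) \<le> W"
proof -
  have "(\<Sum>i<n. weight i) = (\<Sum>i<n. measure_pmf.expectation R (indicator {r. i \<in> U r}))"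
    by (simp add: weight_def)
  also have "\<dots> = measure_pmf.expectation R (\<lambda>r. \<Sum>i<n. indicator {r. i \<in> U r} r)"
    by (rule Bochner_Integration.integral_sum [symmetric]) (rule integrable_pmf_indicator)
  also have "\<dots> \<le> measure_pmf.expectation R (\<lambda>r. W)"
  proof (intro integral_mono_AE)
    show "integrable R (\<lambda>r. \<Sum>i<n. indicator {r. i \<in> U r} r :: real)"
      by (intro Bochner_Integration.integrable_sum integrable_pmf_indicator)
    show "AE r in R. (\<Sum>i<n. indicator {r. i \<in> U r} r) \<le> W"
      unfolding AE_measure_pmf_iff
    proof
      fix r assume r: "r \<in> set_pmf R"
      have "(\<Sum>i<n. indicator {r. i \<in> U r} r :: real) = real (card (U r))"
        using U_subset[OF r]
        by (simp add: indicator_def sum.If_cases Int_absorb1)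
      then show "(\<Sum>i<n. indicator {r. i \<in> U r} r) \<le> W" using card_U[OF r] by simp
    qed
  qed simp
  finally show ?thesis by simp
qed

lemma card_kernel_le:
  assumes "0 < \<tau>"
  shows "real (card (kernel \<tau>)) \<le> W / \<tau>"
proof -
  have "\<tau> * real (card (kernel \<tau>)) = (\<Sum>i\<in>kernel \<tau>. \<tau>)" by simp
  also have "\<dots> \<le> (\<Sum>i\<in>kernel \<tau>. weight i)" by (intro sum_mono) (auto simp: kernel_def)
  also have "\<dots> \<le> (\<Sum>i<n. weight i)"
    by (intro sum_mono2) (auto simp: kernel_def weight_nonneg)
  also have "\<dots> \<le> W" by (rule sum_weight_le)
  finally show ?thesis using assms by (simp add: field_simps)
qed

lemma finite_Q: "r \<in> set_pmf R \<Longrightarrow> x \<in> strings A n \<Longrightarrow> finite (Q r x)"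
  using Q_subset U_subset by (meson finite_lessThan finite_subset)

lemma card_Q_Diff: "r \<in> set_pmf R \<Longrightarrow> x \<in> strings A n \<Longrightarrow> card (Q r x - K) \<le> q"
  using card_mono[OF finite_Q, of r x "Q r x - K"] card_Q[of r x] by auto

section \<open>Bounded differences, unbiasedness and tails of the estimates\<close>

lemma integrable_estimate:
  fixes p :: real
  assumes "0 < p" "p \<le> 1" "x \<in> strings A n"
  shows "integrable R (\<lambda>r. if acc b r x \<and> avoids \<tau> \<tau>' (Q r x) \<and> Q r x - kernel \<tau> \<subseteq> S
     then 1 / p ^ card (Q r x - kernel \<tau>) else 0)"
proof (rule measure_pmf.integrable_const_bound[where B = "1 / p ^ q"])
  have "1 / p ^ card (Q r x - kernel \<tau>) \<le> 1 / p ^ q" if "r \<in> set_pmf R" for r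
    using assms card_Q_Diff[OF that] by (intro divide_left_mono power_decreasing) auto
  then show "AE r in R. norm (if acc b r x \<and> avoids \<tau> \<tau>' (Q r x) \<and> Q r x - kernel \<tau> \<subseteq> S
     then 1 / p ^ card (Q r x - kernel \<tau>) else 0) \<le> 1 / p ^ q"
    using assms by (simp add: AE_measure_pmf_iff)
qed simp

text \<open>Adding \<open>i\<close> changes the contribution of \<open>r\<close> only if
  \<open>i\<close> is queried and lies outside the kernel. On an avoided level such an
  \<open>i\<close> has weight below \<open>\<tau>'\<close>. The tests concerned have total
  probability at most \<open>weight i\<close>, and each contributes at most
  \<open>1 / p ^ q\<close>.\<close>

lemma estimate_diff:
  assumes "0 < p" "p \<le> 1" "x \<in> strings A n" "i < n"
  shows "\<bar>estimate \<tau> \<tau>' p b (insert i S) x - estimate \<tau> \<tau>' p b S x\<bar>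
    \<le> (if weight i < \<tau>' then weight i / p ^ q else 0)"
proof -
  define g where "g S r = (if acc b r x \<and> avoids \<tau> \<tau>' (Q r x) \<and> Q r x - kernel \<tau> \<subseteq> S
     then 1 / p ^ card (Q r x - kernel \<tau>) else 0)" for S r
  define B where "B r = (if weight i < \<tau>' then indicator {r. i \<in> U r} r / p ^ q else 0)" for r
  have int: "integrable R (g S)" for S
    unfolding g_def using assms by (intro integrable_estimate) auto
  have "\<bar>estimate \<tau> \<tau>' p b (insert i S) x - estimate \<tau> \<tau>' p b S x\<bar>
      = \<bar>measure_pmf.expectation R (\<lambda>r. g (insert i S) r - g S r)\<bar>"
    using int by (simp add: estimate_def g_def[symmetric, abs_def] g_def[symmetric])
  also have "\<dots> \<le> measure_pmf.expectation R (\<lambda>r. \<bar>g (insert i S) r - g S r\<bar>)"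
    by (rule integral_abs_bound)
  also have "\<dots> \<le> measure_pmf.expectation R B"
  proof (intro integral_mono_AE)
    show "AE r in R. \<bar>g (insert i S) r - g S r\<bar> \<le> B r"
      unfolding AE_measure_pmf_iff
    proof
      fix r assume r: "r \<in> set_pmf R"
      have le: "1 / p ^ card (Q r x - kernel \<tau>) \<le> 1 / p ^ q"
        using assms card_Q_Diff[OF r] by (intro divide_left_mono power_decreasing) auto
      have Bn: "0 \<le> B r" using assms by (simp add: B_def)
      show "\<bar>g (insert i S) r - g S r\<bar> \<le> B r"
      proof (cases "g (insert i S) r = g S r")
        case False
        then have *: "avoids \<tau> \<tau>' (Q r x)" "i \<in> Q r x" "i \<notin> kernel \<tau>"
          by (auto simp: g_def split: if_splits)
        then have "weight i < \<tau>'" using assms by (force simp: avoids_def kernel_def)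
        moreover have "i \<in> U r" using * Q_subset[OF r assms(3)] by auto
        moreover have "\<bar>g (insert i S) r - g S r\<bar> \<le> 1 / p ^ card (Q r x - kernel \<tau>)"
          using assms by (auto simp: g_def)
        ultimately show ?thesis using le by (simp add: B_def)
      qed (use Bn in simp)
    qed
    show "integrable R B"
      unfolding B_def[abs_def] using integrable_pmf_indicator by (cases "weight i < \<tau>'") auto
  qed (use int in simp)
  also have "\<dots> = (if weight i < \<tau>' then weight i / p ^ q else 0)"
    by (simp add: B_def[abs_def] weight_def)
  finally show ?thesis .
qed

text \<open>In each square, one factor \<open>weight i\<close> is below \<open>\<tau>'\<close> and
  the other sums to at most \<open>W\<close>. The upper threshold \<open>\<tau>\<close> does not
  enter, and this gap is what later beats the number of kernel contents.\<close>

lemma sum_diff_bound: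
  assumes "0 < p" "0 < \<tau>'"
  shows "(\<Sum>i<n. (if weight i < \<tau>' then weight i / p ^ q else 0)\<^sup>2) \<le> \<tau>' * W / p ^ (2 * q)"
proof -
  have "(\<Sum>i<n. (if weight i < \<tau>' then weight i / p ^ q else 0)\<^sup>2)
      \<le> (\<Sum>i<n. \<tau>' / p ^ (2 * q) * weight i)"
  proof (intro sum_mono)
    fix i
    show "(if weight i < \<tau>' then weight i / p ^ q else 0)\<^sup>2 \<le> \<tau>' / p ^ (2 * q) * weight i"
    proof (cases "weight i < \<tau>'")
      case True
      have "(weight i / p ^ q)\<^sup>2 = weight i * weight i / p ^ (2 * q)"
        by (simp add: power_divide power2_eq_square mult.commute[of 2] power_mult)
      also have "\<dots> \<le> \<tau>' * weight i / p ^ (2 * q)"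
        using True assms weight_nonneg by (intro divide_right_mono mult_right_mono) auto
      finally show ?thesis using True by simp
    qed (use assms weight_nonneg in simp)
  qed
  also have "\<dots> = \<tau>' / p ^ (2 * q) * (\<Sum>i<n. weight i)" by (simp add: sum_distrib_left)
  also have "\<dots> \<le> \<tau>' / p ^ (2 * q) * W"
    using assms by (intro mult_left_mono sum_weight_le) auto
  finally show ?thesis by simp
qed

lemma expectation_estimate:
  assumes "0 < p" "p \<le> 1" "x \<in> strings A n"
  shows "measure_pmf.expectation (random_subset {..<n} p) (\<lambda>S. estimate \<tau> \<tau>' p b S x)
    = measure_pmf.prob R {r. acc b r x \<and> avoids \<tau> \<tau>' (Q r x)}"
proof -
  let ?P = "random_subset {..<n} p"
  define g where "g S r = (if acc b r x \<and> avoids \<tau> \<tau>' (Q r x) \<and> Q r x - kernel \<tau> \<subseteq> S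
     then 1 / p ^ card (Q r x - kernel \<tau>) else 0)" for S r
  have int: "integrable R (g S)" for S
    unfolding g_def using assms by (intro integrable_estimate) auto
  \<comment> \<open>The expectation over \<open>S\<close> is a finite sum, so exchanging it with the
    expectation over \<open>R\<close> takes only linearity.\<close>
  have fin: "measure_pmf.expectation ?P h = (\<Sum>S\<in>Pow {..<n}. h S * pmf ?P S)"
    for h :: "nat set \<Rightarrow> real"
    using set_random_subset by (intro integral_measure_pmf_real) auto
  have "measure_pmf.expectation ?P (\<lambda>S. estimate \<tau> \<tau>' p b S x)
      = (\<Sum>S\<in>Pow {..<n}. measure_pmf.expectation R (\<lambda>r. g S r * pmf ?P S))"
    using int by (simp add: fin estimate_def g_def)
  also have "\<dots> = measure_pmf.expectation R (\<lambda>r. \<Sum>S\<in>Pow {..<n}. g S r * pmf ?P S)"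
    using int by (intro Bochner_Integration.integral_sum [symmetric]) simp
  also have "\<dots> = measure_pmf.expectation R (\<lambda>r. measure_pmf.expectation ?P (\<lambda>S. g S r))"
    by (simp add: fin)
  also have "\<dots> = measure_pmf.expectation R (indicator {r. acc b r x \<and> avoids \<tau> \<tau>' (Q r x)})"
  proof (intro integral_cong_AE)
    show "AE r in R. measure_pmf.expectation ?P (\<lambda>S. g S r)
        = indicator {r. acc b r x \<and> avoids \<tau> \<tau>' (Q r x)} r"
      unfolding AE_measure_pmf_iff
    proof
      fix r assume r: "r \<in> set_pmf R"
      let ?T = "Q r x - kernel \<tau>"
      have "?T \<subseteq> {..<n}" using Q_subset[OF r assms(3)] U_subset[OF r] by auto
      from prob_subset_random_subset[OF _ _ _ this] assms
      have 1: "measure_pmf.expectation ?P (\<lambda>S. (if ?T \<subseteq> S then 1 else 0) * (1 / p ^ card ?T)) = 1"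
        by simp
      have 2: "g S r = indicator {r. acc b r x \<and> avoids \<tau> \<tau>' (Q r x)} r *
          ((if ?T \<subseteq> S then 1 else 0) * (1 / p ^ card ?T))" for S
        by (auto simp: g_def)
      show "measure_pmf.expectation ?P (\<lambda>S. g S r)
        = indicator {r. acc b r x \<and> avoids \<tau> \<tau>' (Q r x)} r"
        unfolding 2 integral_mult_right_zero 1 by simp
    qed
  qed auto
  finally show ?thesis by simp
qed

lemma estimate_upper_tail:
  assumes "0 < p" "p \<le> 1" "x \<in> strings A n" "0 < \<tau>'" "0 \<le> \<delta>"
    and "measure_pmf.prob R {r. acc b r x \<and> avoids \<tau> \<tau>' (Q r x)} \<le> m"
  shows "measure_pmf.prob (random_subset {..<n} p) {S. m + \<delta> \<le> estimate \<tau> \<tau>' p b S x}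
    \<le> exp (- 2 * \<delta>\<^sup>2 * p ^ (2 * q) / (\<tau>' * W))"
proof -
  let ?P = "random_subset {..<n} p" and ?h = "\<lambda>S. estimate \<tau> \<tau>' p b S x"
  have "measure_pmf.prob ?P {S. m + \<delta> \<le> ?h S}
      \<le> measure_pmf.prob ?P {S. measure_pmf.expectation ?P ?h + \<delta> \<le> ?h S}"
    using assms by (intro measure_pmf.finite_measure_mono) (auto simp: expectation_estimate)
  also have "\<dots> \<le> exp (- 2 * \<delta>\<^sup>2 / (\<tau>' * W / p ^ (2 * q)))"
    using assms W_pos
    by (intro bounded_differences_upper_tail[OF _ _ _ estimate_diff sum_diff_bound]) auto
  finally show ?thesis by simp
qed

lemma estimate_lower_tail:
  assumes "0 < p" "p \<le> 1" "x \<in> strings A n" "0 < \<tau>'" "0 \<le> \<delta>"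
    and "m \<le> measure_pmf.prob R {r. acc b r x \<and> avoids \<tau> \<tau>' (Q r x)}"
  shows "measure_pmf.prob (random_subset {..<n} p) {S. estimate \<tau> \<tau>' p b S x \<le> m - \<delta>}
    \<le> exp (- 2 * \<delta>\<^sup>2 * p ^ (2 * q) / (\<tau>' * W))"
proof -
  let ?P = "random_subset {..<n} p" and ?h = "\<lambda>S. estimate \<tau> \<tau>' p b S x"
  have "measure_pmf.prob ?P {S. ?h S \<le> m - \<delta>}
      \<le> measure_pmf.prob ?P {S. ?h S \<le> measure_pmf.expectation ?P ?h - \<delta>}"
    using assms by (intro measure_pmf.finite_measure_mono) (auto simp: expectation_estimate)
  also have "\<dots> \<le> exp (- 2 * \<delta>\<^sup>2 / (\<tau>' * W / p ^ (2 * q)))"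
    using assms W_pos
    by (intro bounded_differences_lower_tail[OF _ _ _ estimate_diff sum_diff_bound]) auto
  finally show ?thesis by simp
qed

text \<open>This makes the estimate computable from the sample and a guess of the kernel contents. A
  test contributes only if all its queries lie in \<open>S \<union> kernel \<tau>\<close>, and then
  it behaves alike on both inputs. The argument runs in both directions, to exclude a test that
  contributes on \<open>y\<close> only.\<close>

lemma estimate_cong:
  assumes "\<And>i. i \<in> S \<union> kernel \<tau> \<Longrightarrow> x ! i = y ! i"
  shows "estimate \<tau> \<tau>' p b S x = estimate \<tau> \<tau>' p b S y"
proof -
  have *: "Q r y = Q r x \<and> acc b r y = acc b r x"
    if "Q r x - kernel \<tau> \<subseteq> S" "\<And>i. i \<in> S \<union> kernel \<tau> \<Longrightarrow> x ! i = y ! i" for r x y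
    using that by (intro conjI Q_cong acc_cong) auto
  have "(if acc b r x \<and> avoids \<tau> \<tau>' (Q r x) \<and> Q r x - kernel \<tau> \<subseteq> S
     then 1 / p ^ card (Q r x - kernel \<tau>) else 0) =
     (if acc b r y \<and> avoids \<tau> \<tau>' (Q r y) \<and> Q r y - kernel \<tau> \<subseteq> S
     then 1 / p ^ card (Q r y - kernel \<tau>) else 0)" for r
    using *[of r x y] *[of r y x] assms by (smt (verit))
  then show ?thesis unfolding estimate_def by simp
qed

section \<open>Union bound over the kernel contents\<close>

definition variants :: "nat set \<Rightarrow> 's list \<Rightarrow> 's list set" where
  "variants K x = {w \<in> strings A n. \<forall>i<n. i \<notin> K \<longrightarrow> w ! i = x ! i}"

lemma card_variants_le:
  assumes "finite A" "K \<subseteq> {..<n}"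
  shows "finite (variants K x)" "card (variants K x) \<le> card A ^ card K"
proof -
  have finK: "finite K" using assms finite_subset by blast
  have inj: "inj_on (\<lambda>w. restrict ((!) w) K) (variants K x)"
  proof (intro inj_onI nth_equalityI)
    fix v w i
    assume *: "v \<in> variants K x" "w \<in> variants K x" "restrict ((!) v) K = restrict ((!) w) K"
    show "length v = length w" using * by (simp add: variants_def strings_def)
    assume "i < length v"
    then show "v ! i = w ! i"
    proof (cases "i \<in> K")
      case True
      with fun_cong[OF *(3), of i] show ?thesis by simp
    next
      case False
      with *(1,2) \<open>i < length v\<close> show ?thesis by (auto simp: variants_def strings_def)
    qed
  qed
  have sub: "(\<lambda>w. restrict ((!) w) K) ` variants K x \<subseteq> K \<rightarrow>\<^sub>E A"
  proof (intro image_subsetI restrict_PiE_iff[THEN iffD2] ballI)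
    fix w i assume "w \<in> variants K x" "i \<in> K"
    then have "set w \<subseteq> A" "i < length w" using assms(2) by (auto simp: variants_def strings_def)
    then show "w ! i \<in> A" using nth_mem by blast
  qed
  have finE: "finite (K \<rightarrow>\<^sub>E A)" using finK assms by (intro finite_PiE) auto
  show "finite (variants K x)" using finE sub inj finite_imageD finite_subset by blast
  show "card (variants K x) \<le> card A ^ card K"
    using card_inj_on_le[OF inj sub finE] finK by (simp add: card_PiE)
qed

lemma kernel_subset: "kernel \<tau> \<subseteq> {..<n}"
  by (auto simp: kernel_def)

text \<open>The strings \<open>w\<close> in the bad event depend on \<open>S\<close>, so a direct
  union bound is impossible. Replacing each of them by a variant of \<open>x\<close> on the kernel
  gives a family that is fixed before \<open>S\<close> is drawn.\<close>

lemma variant_estimate_upper_tail: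
  assumes "finite A" "0 < p" "p \<le> 1" "x \<in> strings A n" "0 < \<tau>'" "0 \<le> \<delta>"
    and m: "\<And>w. w \<in> variants (kernel \<tau>) x \<Longrightarrow> measure_pmf.prob R {r. acc b r w} \<le> m"
  shows "measure_pmf.prob (random_subset {..<n} p)
      {S. \<exists>w\<in>strings A n. (\<forall>i\<in>S - kernel \<tau>. w ! i = x ! i) \<and> m + \<delta> \<le> estimate \<tau> \<tau>' p b S w}
    \<le> real (card A) ^ card (kernel \<tau>) * exp (- 2 * \<delta>\<^sup>2 * p ^ (2 * q) / (\<tau>' * W))"
    (is "measure_pmf.prob ?P ?bad \<le> _ * ?e")
proof -
  let ?B = "variants (kernel \<tau>) x"
  have fin: "finite ?B" and card: "card ?B \<le> card A ^ card (kernel \<tau>)"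
    using card_variants_le[OF assms(1) kernel_subset] by auto
  have "measure_pmf.prob ?P ?bad \<le> measure_pmf.prob ?P (\<Union>w\<in>?B. {S. m + \<delta> \<le> estimate \<tau> \<tau>' p b S w})"
  proof (intro measure_pmf.finite_measure_mono_AE)
    have "\<exists>w\<in>?B. m + \<delta> \<le> estimate \<tau> \<tau>' p b S w"
      if S: "S \<subseteq> {..<n}" and w: "w \<in> strings A n" "\<forall>i\<in>S - kernel \<tau>. w ! i = x ! i"
        "m + \<delta> \<le> estimate \<tau> \<tau>' p b S w" for S w
    proof -
      \<comment> \<open>\<open>w'\<close> has the kernel contents of \<open>w\<close> and agrees
        with \<open>x\<close> elsewhere. It coincides with \<open>w\<close> on \<open>S\<close> and
        on the kernel, hence has the same estimate.\<close>
      define w' where "w' = map (\<lambda>i. if i \<in> kernel \<tau> then w ! i else x ! i) [0..<n]"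
      have "w' \<in> ?B"
        using w(1) assms(4) nth_mem by (auto simp: w'_def variants_def strings_def)
      moreover have "estimate \<tau> \<tau>' p b S w = estimate \<tau> \<tau>' p b S w'"
        using S w(2) kernel_subset[of \<tau>] by (intro estimate_cong) (auto simp: w'_def)
      ultimately show ?thesis using w(3) by auto
    qed
    then have "S \<in> ?bad \<longrightarrow> S \<in> (\<Union>w\<in>?B. {S. m + \<delta> \<le> estimate \<tau> \<tau>' p b S w})"
      if "S \<subseteq> {..<n}" for S
      using that by blast
    then show "AE S in ?P. S \<in> ?bad \<longrightarrow> S \<in> (\<Union>w\<in>?B. {S. m + \<delta> \<le> estimate \<tau> \<tau>' p b S w})"
      using set_random_subset[of "{..<n}" p] unfolding AE_measure_pmf_iff by blast
  qed simp
  also have "\<dots> \<le> (\<Sum>w\<in>?B. measure_pmf.prob ?P {S. m + \<delta> \<le> estimate \<tau> \<tau>' p b S w})"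
    using fin by (intro measure_pmf.finite_measure_subadditive_finite) auto
  also have "\<dots> \<le> (\<Sum>w\<in>?B. ?e)"
  proof (intro sum_mono estimate_upper_tail assms)
    fix w assume w: "w \<in> ?B"
    then show "w \<in> strings A n" by (simp add: variants_def)
    show "measure_pmf.prob R {r. acc b r w \<and> avoids \<tau> \<tau>' (Q r w)} \<le> m"
      by (rule order_trans[OF _ m[OF w]]) (auto intro: measure_pmf.finite_measure_mono)
  qed
  also have "\<dots> = real (card ?B) * ?e" by simp
  also have "\<dots> \<le> real (card A) ^ card (kernel \<tau>) * ?e"
    using card by (intro mult_right_mono) (simp_all flip: of_nat_power)
  finally show ?thesis .
qed

section \<open>Pigeonhole over the weight levels\<close>

text \<open>The \<open>q + 1\<close> intervals are disjoint. If each contained the weight of a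
  queried coordinate, these coordinates would be distinct and exceed the \<open>q\<close> available
  queries.\<close>

lemma exists_avoided_level:
  assumes "decseq \<tau>" "r \<in> set_pmf R" "x \<in> strings A n"
  shows "\<exists>j\<le>q. avoids (\<tau> j) (\<tau> (Suc j)) (Q r x)"
proof (rule ccontr)
  assume "\<not> ?thesis"
  then have "\<forall>j\<in>{..q}. \<exists>i. i \<in> Q r x \<and> \<tau> (Suc j) \<le> weight i \<and> weight i < \<tau> j"
    by (auto simp: avoids_def)
  then obtain g where g: "\<And>j. j \<le> q \<Longrightarrow> g j \<in> Q r x"
    "\<And>j. j \<le> q \<Longrightarrow> \<tau> (Suc j) \<le> weight (g j)" "\<And>j. j \<le> q \<Longrightarrow> weight (g j) < \<tau> j"
    unfolding bchoice_iff by auto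
  have "g j \<noteq> g k" if "j < k" "k \<le> q" for j k
  proof -
    have "\<tau> k \<le> \<tau> (Suc j)" using assms(1) that by (simp add: decseqD)
    then show ?thesis using g(2)[of j] g(3)[of k] that by force
  qed
  then have "inj_on g {..q}"
    by (intro inj_onI) (metis atMost_iff linorder_neqE_nat)
  moreover have "finite (Q r x)"
    using Q_subset[OF assms(2,3)] U_subset[OF assms(2)] by (meson finite_lessThan finite_subset)
  ultimately have "card {..q} \<le> card (Q r x)"
    using g(1) by (intro card_inj_on_le) auto
  then show False using card_Q[OF assms(2,3)] by simp
qed

text \<open>Every test in the support avoids some level, so the accepting tests are covered by
  \<open>q + 1\<close> events, one of which has at least the average share.\<close>

lemma exists_heavy_level:
  assumes "decseq \<tau>" "x \<in> strings A n" "real (Suc q) * a \<le> measure_pmf.prob R {r. acc b r x}"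
  shows "\<exists>j\<le>q. a \<le> measure_pmf.prob R {r. acc b r x \<and> avoids (\<tau> j) (\<tau> (Suc j)) (Q r x)}"
proof (rule ccontr)
  assume *: "\<not> ?thesis"
  let ?D = "\<lambda>j. {r. acc b r x \<and> avoids (\<tau> j) (\<tau> (Suc j)) (Q r x)}"
  have "measure_pmf.prob R {r. acc b r x} \<le> measure_pmf.prob R (\<Union>j\<in>{..q}. ?D j)"
    using exists_avoided_level[OF assms(1) _ assms(2)]
    by (intro measure_pmf.finite_measure_mono_AE) (auto simp: AE_measure_pmf_iff)
  also have "\<dots> \<le> (\<Sum>j\<le>q. measure_pmf.prob R (?D j))"
    by (intro measure_pmf.finite_measure_subadditive_finite) auto
  also have "\<dots> < (\<Sum>j\<le>q. a)"
    using * by (intro sum_strict_mono) (auto simp: not_le dest: leD)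
  finally show False using assms(3) by simp
qed

section \<open>The voting rule and its two kinds of error\<close>

text \<open>The search over \<open>w\<close> is a search over kernel contents: \<open>w\<close> is
  tied to the sample outside the kernel, and its remaining entries do not affect the estimate.
  Sampled values inside the kernel are ignored.\<close>

definition votes :: "(nat \<Rightarrow> real) \<Rightarrow> real \<Rightarrow> real \<Rightarrow> bool \<Rightarrow> nat set \<Rightarrow> (nat \<rightharpoonup> 's) \<Rightarrow> bool" where
  "votes \<tau> p \<theta> b S v \<longleftrightarrow> (\<exists>j\<le>q. \<exists>w\<in>strings A n.
     (\<forall>i\<in>S - kernel (\<tau> j). v i = Some (w ! i)) \<and> \<theta> \<le> estimate (\<tau> j) (\<tau> (Suc j)) p b S w)"

text \<open>By \<open>small\<close>, changing \<open>x\<close> on a kernel stays in the robustness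
  ball, so every candidate has mean at most \<open>\<sigma>\<close> for the wrong answer. Reaching
  the threshold \<open>2 * \<sigma>\<close> is then a deviation by \<open>\<sigma>\<close>. The
  union bound runs over the kernel contents and over the \<open>q + 1\<close> levels.\<close>

lemma prob_wrong_vote:
  assumes "finite A" "0 < p" "p \<le> 1" "x \<in> strings A n" "\<And>j. 0 < \<tau> j" "0 \<le> \<sigma>"
    and small: "\<And>j. j \<le> q \<Longrightarrow> W / \<tau> j \<le> \<rho> * real n"
    and rare: "\<And>j. j \<le> q \<Longrightarrow> exp (real (card A) * (W / \<tau> j)) *
       exp (- 2 * \<sigma>\<^sup>2 * p ^ (2 * q) / (\<tau> (Suc j) * W)) \<le> \<epsilon> / real (Suc q)"
    and wrong: "\<And>w. w \<in> hamming_ball A n \<rho> x \<Longrightarrow> measure_pmf.prob R {r. acc b r w} \<le> \<sigma>"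
  shows "measure_pmf.prob (random_subset {..<n} p)
    {S. votes \<tau> p (2 * \<sigma>) b S (\<lambda>i. if i \<in> S then Some (x ! i) else None)} \<le> \<epsilon>"
proof -
  let ?P = "random_subset {..<n} p"
  let ?bad = "\<lambda>j. {S. \<exists>w\<in>strings A n. (\<forall>i\<in>S - kernel (\<tau> j). w ! i = x ! i) \<and>
     \<sigma> + \<sigma> \<le> estimate (\<tau> j) (\<tau> (Suc j)) p b S w}"
  have "{S. votes \<tau> p (2 * \<sigma>) b S (\<lambda>i. if i \<in> S then Some (x ! i) else None)} \<subseteq> (\<Union>j\<in>{..q}. ?bad j)"
  proof clarify
    fix S assume "votes \<tau> p (2 * \<sigma>) b S (\<lambda>i. if i \<in> S then Some (x ! i) else None)"
    then obtain j w where "j \<le> q" "w \<in> strings A n" "\<forall>i\<in>S - kernel (\<tau> j). w ! i = x ! i"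
      "\<sigma> + \<sigma> \<le> estimate (\<tau> j) (\<tau> (Suc j)) p b S w"
      unfolding votes_def by auto
    then show "S \<in> (\<Union>j\<in>{..q}. ?bad j)" by blast
  qed
  then have "measure_pmf.prob ?P {S. votes \<tau> p (2 * \<sigma>) b S (\<lambda>i. if i \<in> S then Some (x ! i) else None)}
     \<le> measure_pmf.prob ?P (\<Union>j\<in>{..q}. ?bad j)"
    by (intro measure_pmf.finite_measure_mono) simp_all
  also have "\<dots> \<le> (\<Sum>j\<le>q. measure_pmf.prob ?P (?bad j))"
    by (intro measure_pmf.finite_measure_subadditive_finite) auto
  also have "\<dots> \<le> (\<Sum>j\<le>q. \<epsilon> / real (Suc q))"
  proof (intro sum_mono)
    fix j assume "j \<in> {..q}"
    then have j: "j \<le> q" by simp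
    have ball: "variants (kernel (\<tau> j)) x \<subseteq> hamming_ball A n \<rho> x"
    proof
      fix w assume w: "w \<in> variants (kernel (\<tau> j)) x"
      then have "{i. i < n \<and> w ! i \<noteq> x ! i} \<subseteq> kernel (\<tau> j)" by (auto simp: variants_def)
      then have "card {i. i < n \<and> w ! i \<noteq> x ! i} \<le> card (kernel (\<tau> j))"
        by (intro card_mono) (auto simp: kernel_def)
      then have "real (card {i. i < n \<and> w ! i \<noteq> x ! i}) \<le> \<rho> * real n"
        using card_kernel_le[of "\<tau> j"] assms(5)[of j] small[OF j] by simp
      then show "w \<in> hamming_ball A n \<rho> x" using w by (simp add: hamming_ball_def variants_def)
    qed
    have "measure_pmf.prob ?P (?bad j) \<le> real (card A) ^ card (kernel (\<tau> j)) *
        exp (- 2 * \<sigma>\<^sup>2 * p ^ (2 * q) / (\<tau> (Suc j) * W))"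
      using ball wrong by (intro variant_estimate_upper_tail assms) auto
    also have "real (card A) ^ card (kernel (\<tau> j)) \<le> exp (real (card A) * (W / \<tau> j))"
    proof -
      \<comment> \<open>Passing to the base \<open>exp (card A)\<close>, which is at least 1, makes
        the power monotone in its exponent even for an empty alphabet.\<close>
      have "real (card A) \<le> exp (real (card A))"
        using exp_ge_add_one_self[of "real (card A)"] by linarith
      then have "real (card A) ^ card (kernel (\<tau> j)) \<le> exp (real (card A)) ^ card (kernel (\<tau> j))"
        by (intro power_mono) auto
      also have "\<dots> = exp (real (card A) * real (card (kernel (\<tau> j))))"
        by (simp add: exp_of_nat_mult[symmetric] mult.commute)
      also have "\<dots> \<le> exp (real (card A) * (W / \<tau> j))"
        using card_kernel_le[OF assms(5)[of j]]
        by (simp only: exp_le_cancel_iff) (rule mult_left_mono, simp_all)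
      finally show ?thesis .
    qed
    finally show "measure_pmf.prob ?P (?bad j) \<le> \<epsilon> / real (Suc q)"
      using rare[OF j] by simp
  qed
  also have "\<dots> = \<epsilon>" by simp
  finally show ?thesis .
qed

text \<open>Some level carries at least \<open>3 * \<sigma>\<close> of the correct answers, and
  there \<open>x\<close> itself is a witness for the vote unless its estimate drops by
  \<open>\<sigma>\<close>. A single candidate on a single level suffices, so there is no union
  bound.\<close>

lemma prob_missing_vote:
  assumes "0 < p" "p \<le> 1" "x \<in> strings A n" "\<And>j. 0 < \<tau> j" "0 < \<sigma>" "decseq \<tau>"
    and rare: "\<And>j. j \<le> q \<Longrightarrow> exp (real (card A) * (W / \<tau> j)) *
       exp (- 2 * \<sigma>\<^sup>2 * p ^ (2 * q) / (\<tau> (Suc j) * W)) \<le> \<epsilon> / real (Suc q)"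
    and right: "real (Suc q) * (3 * \<sigma>) \<le> measure_pmf.prob R {r. acc b r x}"
  shows "measure_pmf.prob (random_subset {..<n} p)
    {S. \<not> votes \<tau> p (2 * \<sigma>) b S (\<lambda>i. if i \<in> S then Some (x ! i) else None)} \<le> \<epsilon>"
proof -
  let ?P = "random_subset {..<n} p"
  obtain j where j: "j \<le> q"
    and "3 * \<sigma> \<le> measure_pmf.prob R {r. acc b r x \<and> avoids (\<tau> j) (\<tau> (Suc j)) (Q r x)}"
    using exists_heavy_level[OF assms(6,3) right] by blast
  then have tail: "measure_pmf.prob ?P {S. estimate (\<tau> j) (\<tau> (Suc j)) p b S x \<le> 3 * \<sigma> - \<sigma>}
      \<le> exp (- 2 * \<sigma>\<^sup>2 * p ^ (2 * q) / (\<tau> (Suc j) * W))"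
    using assms by (intro estimate_lower_tail) auto
  have "measure_pmf.prob ?P
      {S. \<not> votes \<tau> p (2 * \<sigma>) b S (\<lambda>i. if i \<in> S then Some (x ! i) else None)}
    \<le> measure_pmf.prob ?P {S. estimate (\<tau> j) (\<tau> (Suc j)) p b S x \<le> 3 * \<sigma> - \<sigma>}"
    using j assms(3) by (intro measure_pmf.finite_measure_mono) (force simp: votes_def)+
  also note tail
  \<comment> \<open>The additional factor is at least 1. It is inserted so that the same condition
    \<open>rare\<close> serves both kinds of error.\<close>
  also have "exp (- 2 * \<sigma>\<^sup>2 * p ^ (2 * q) / (\<tau> (Suc j) * W)) \<le> exp (real (card A) * (W / \<tau> j)) *
       exp (- 2 * \<sigma>\<^sup>2 * p ^ (2 * q) / (\<tau> (Suc j) * W))"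
    using W_pos assms(4)[of j] by simp
  also have "\<dots> \<le> \<epsilon> / real (Suc q)" by (rule rare[OF j])
  also have "\<dots> \<le> \<epsilon>"
  proof -
    have "0 \<le> \<epsilon> / real (Suc q)" by (rule order_trans[OF _ rare[OF j]]) simp
    then have "0 \<le> \<epsilon>" by (simp add: zero_le_divide_iff)
    then show ?thesis by (simp add: divide_le_eq mult_right_mono[of 1] field_simps)
  qed
  finally show ?thesis .
qed

end

section \<open>Decision trees and independent repetitions\<close>

primrec queried :: "('s, 'b) qtree \<Rightarrow> 's list \<Rightarrow> nat set" where
  "queried (Output b) x = {}"
| "queried (Query i k) x = insert i (queried (k (x ! i)) x)"

primrec reachable :: "'s set \<Rightarrow> ('s, 'b) qtree \<Rightarrow> nat set" where
  "reachable A (Output b) = {}"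
| "reachable A (Query i k) = insert i (\<Union>a\<in>A. reachable A (k a))"

lemma queried_subset_reachable:
  assumes "queries_at_most A n t l" "x \<in> strings A n"
  shows "queried t x \<subseteq> reachable A t"
  using assms(1)
proof (induction t arbitrary: l)
  case (Query i k)
  then have "x ! i \<in> A" using assms(2) nth_mem by (force simp: strings_def)
  then show ?case using Query by fastforce
qed simp

lemma card_queried_le:
  assumes "queries_at_most A n t l" "x \<in> strings A n"
  shows "card (queried t x) \<le> l"
  using assms(1)
proof (induction t arbitrary: l)
  case (Query i k)
  then have "x ! i \<in> A" using assms(2) nth_mem by (force simp: strings_def)
  then have "card (queried (k (x ! i)) x) \<le> l - 1" using Query by auto
  then show ?case using Query.prems card_insert_le_m1[of l "queried (k (x ! i)) x" i] by simp
qed simp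

lemma reachable_subset: "queries_at_most A n t l \<Longrightarrow> reachable A t \<subseteq> {..<n}"
proof (induction t arbitrary: l)
  case (Query i k)
  then show ?case by fastforce
qed simp

text \<open>A tree of depth \<open>l\<close> branches over the finite alphabet, so it mentions a
  number of coordinates independent of \<open>n\<close>. The summand 2 in the base leaves room for
  the root of each subtree.\<close>

lemma card_reachable_le:
  assumes "finite A" "queries_at_most A n t l"
  shows "card (reachable A t) \<le> (card A + 2) ^ l"
  using assms(2)
proof (induction t arbitrary: l)
  case (Query i k)
  then obtain l' where l: "l = Suc l'" by (cases l) auto
  have "card (reachable A (Query i k)) \<le> Suc (card (\<Union>a\<in>A. reachable A (k a)))"
    by (simp add: card_insert_le_m1 card_insert_if)
  also have "card (\<Union>a\<in>A. reachable A (k a)) \<le> (\<Sum>a\<in>A. card (reachable A (k a)))"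
    using assms(1) by (rule card_UN_le)
  also have "\<dots> \<le> (\<Sum>a\<in>A. (card A + 2) ^ l')"
    using Query l by (intro sum_mono) auto
  also have "Suc \<dots> \<le> (card A + 2) ^ l"
  proof -
    have "1 \<le> (card A + 2) ^ l'" by (rule one_le_power) simp
    moreover have "(card A + 2) ^ l = card A * (card A + 2) ^ l' + 2 * (card A + 2) ^ l'"
      unfolding l by (simp add: algebra_simps)
    ultimately show ?thesis by (simp only: sum_constant) simp
  qed
  finally show ?case by simp
qed simp

lemma queried_cong: "(\<And>i. i \<in> queried t x \<Longrightarrow> x ! i = y ! i) \<Longrightarrow> queried t y = queried t x"
  by (induction t) auto

lemma run_cong: "(\<And>i. i \<in> queried t x \<Longrightarrow> x ! i = y ! i) \<Longrightarrow> run t y = run t x"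
  by (induction t) auto

lemma run_query_list:
  "run (query_list js v d) x = d (\<lambda>i. if i \<in> set js then Some (x ! i) else v i)"
proof (induction js arbitrary: v)
  case (Cons j js)
  have "(\<lambda>i. if i \<in> set js then Some (x ! i) else (v(j \<mapsto> x ! j)) i)
     = (\<lambda>i. if i \<in> set (j # js) then Some (x ! i) else v i)" by auto
  then show ?case using Cons[of "v(j \<mapsto> x ! j)"] by (simp only: query_list.simps run.simps)
qed simp

lemma queries_at_most_query_list:
  "set js \<subseteq> {..<n} \<Longrightarrow> length js \<le> l \<Longrightarrow> queries_at_most A n (query_list js v d) l"
  by (induction js arbitrary: v l) auto

section \<open>Independent repetitions\<close>

lemma prob_pair_pmf_Times:
  "measure_pmf.prob (pair_pmf M N) (B \<times> C) = measure_pmf.prob M B * measure_pmf.prob N C"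
proof -
  \<comment> \<open>The product rule used below needs countable sets, hence the intersection with
    the supports.\<close>
  have "measure_pmf.prob (pair_pmf M N) (B \<times> C)
      = measure_pmf.prob (pair_pmf M N) ((B \<times> C) \<inter> set_pmf (pair_pmf M N))"
    by (simp only: measure_Int_set_pmf)
  also have "(B \<times> C) \<inter> set_pmf (pair_pmf M N) = (B \<inter> set_pmf M) \<times> (C \<inter> set_pmf N)"
    by auto
  also have "measure_pmf.prob (pair_pmf M N) \<dots>
      = measure_pmf.prob M (B \<inter> set_pmf M) * measure_pmf.prob N (C \<inter> set_pmf N)"
    by (intro measure_pmf_prob_product countable_Int2 countable_set_pmf)
  finally show ?thesis by (simp only: measure_Int_set_pmf)
qed

text \<open>
  Requiring unanimity of \<open>k\<close> independent runs, with \<open>\<bottom>\<close> otherwise, makes a correct answer less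
  likely, but it increases the ratio of correct to wrong answers from \<open>2\<close> to \<open>2 ^ k\<close>. Only this ratio
  is compared with the number of weight levels, so that \<open>k = O(log l)\<close> suffices.
\<close>

lemma prob_replicate_pmf_all:
  "measure_pmf.prob (replicate_pmf k D) {ts. \<forall>t\<in>set ts. P t} = measure_pmf.prob D {t. P t} ^ k"
proof (induction k)
  case (Suc k)
  have "replicate_pmf (Suc k) D = map_pmf (\<lambda>(t, ts). t # ts) (pair_pmf D (replicate_pmf k D))"
    by (simp add: pair_pmf_def map_bind_pmf bind_assoc_pmf bind_return_pmf)
  moreover have "(\<lambda>(t, ts). t # ts) -` {ts. \<forall>t\<in>set ts. P t} = {t. P t} \<times> {ts. \<forall>t\<in>set ts. P t}"
    by auto
  ultimately show ?case using Suc by (simp add: prob_pair_pmf_Times)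
qed simp

section \<open>The decision rule for one explicit input\<close>

text \<open>The test family consists of \<open>k\<close> independent trees with
  \<open>q = k * l\<close> and \<open>\<sigma> = (1/3) ^ k\<close>. The rule \<open>d\<close> is
  fixed before \<open>x\<close>. A wrong output requires a wrong vote, which costs
  \<open>\<epsilon>\<close>; a failure to output \<open>b\<close> may also come from a missing vote,
  which costs another \<open>\<epsilon>\<close>.\<close>

lemma exists_sample_rule:
  fixes D :: "('s, bool option) qtree pmf" and \<tau> :: "nat \<Rightarrow> real"
  assumes A: "finite A" and D: "\<And>t. t \<in> set_pmf D \<Longrightarrow> queries_at_most A n t l"
    and k: "0 < k" "3 * (k * l + 1) \<le> (2::nat) ^ k"
    and p: "0 < p" "p \<le> 1" and \<tau>: "\<And>j. 0 < \<tau> j" "decseq \<tau>"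
    and W: "W = real k * real ((card A + 2) ^ l)"
    and small: "\<And>j. j \<le> k * l \<Longrightarrow> W / \<tau> j \<le> \<rho> * real n"
    and rare: "\<And>j. j \<le> k * l \<Longrightarrow> exp (real (card A) * (W / \<tau> j)) *
       exp (- 2 * ((1/3) ^ k)\<^sup>2 * p ^ (2 * (k * l)) / (\<tau> (Suc j) * W)) \<le> \<epsilon> / real (Suc (k * l))"
  shows "\<exists>d :: nat set \<Rightarrow> (nat \<rightharpoonup> 's) \<Rightarrow> bool option. \<forall>x\<in>strings A n. \<forall>b.
    (\<forall>w\<in>hamming_ball A n \<rho> x. 2/3 \<le> measure_pmf.prob D {t. run t w \<in> {Some b, None}}) \<longrightarrow>
    measure_pmf.prob (random_subset {..<n} p)
      {S. d S (\<lambda>i. if i \<in> S then Some (x ! i) else None) \<notin> {Some b, None}} \<le> \<epsilon> \<and>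
    (2/3 \<le> measure_pmf.prob D {t. run t x = Some b} \<longrightarrow>
      measure_pmf.prob (random_subset {..<n} p)
      {S. d S (\<lambda>i. if i \<in> S then Some (x ! i) else None) \<noteq> Some b} \<le> 2 * \<epsilon>)"
proof -
  define U :: "('s, bool option) qtree list \<Rightarrow> nat set"
    where "U ts = (\<Union>t\<in>set ts. reachable A t)" for ts
  define Q :: "('s, bool option) qtree list \<Rightarrow> 's list \<Rightarrow> nat set"
    where "Q ts x = (\<Union>t\<in>set ts. queried t x)" for ts x
  define acc :: "bool \<Rightarrow> ('s, bool option) qtree list \<Rightarrow> 's list \<Rightarrow> bool"
    where "acc b ts x \<longleftrightarrow> (\<forall>t\<in>set ts. run t x = Some b)" for b ts x
  have R: "length ts = k" "\<And>t. t \<in> set ts \<Longrightarrow> queries_at_most A n t l"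
    if "ts \<in> set_pmf (replicate_pmf k D)" for ts
    using that D by (auto simp: set_replicate_pmf)
  interpret test_family A n "k * l" W "replicate_pmf k D" U Q acc
  proof
    show "0 < W" using k W by simp
    fix ts x assume ts: "ts \<in> set_pmf (replicate_pmf k D)"
    note R = R[OF ts]
    show "U ts \<subseteq> {..<n}" using R(2) reachable_subset by (fastforce simp: U_def)
    have "card (U ts) \<le> (\<Sum>t\<in>set ts. card (reachable A t))"
      unfolding U_def by (intro card_UN_le) simp
    also have "\<dots> \<le> (\<Sum>t\<in>set ts. (card A + 2) ^ l)"
      using R(2) A by (intro sum_mono card_reachable_le) auto
    also have "\<dots> \<le> k * (card A + 2) ^ l"
      using card_length[of ts] R(1) by simp
    finally show "real (card (U ts)) \<le> W" unfolding W by (metis of_nat_le_iff of_nat_mult)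
    assume x: "x \<in> strings A n"
    show "Q ts x \<subseteq> U ts" using R(2) queried_subset_reachable x by (fastforce simp: Q_def U_def)
    have "card (Q ts x) \<le> (\<Sum>t\<in>set ts. card (queried t x))"
      unfolding Q_def by (intro card_UN_le) simp
    also have "\<dots> \<le> (\<Sum>t\<in>set ts. l)"
      using R(2) x by (intro sum_mono card_queried_le) auto
    also have "\<dots> \<le> k * l"
      using card_length[of ts] R(1) by simp
    finally show "card (Q ts x) \<le> k * l" .
  next
    fix ts x y assume *: "\<And>i. i \<in> Q ts x \<Longrightarrow> x ! i = y ! i"
    show "Q ts y = Q ts x"
      unfolding Q_def using * by (intro SUP_cong refl queried_cong) (auto simp: Q_def)
    have "run t y = run t x" if "t \<in> set ts" for t
      using * that by (intro run_cong) (auto simp: Q_def)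
    then show "acc b ts y = acc b ts x" for b by (simp add: acc_def)
  qed
  have acc_prob: "measure_pmf.prob (replicate_pmf k D) {ts. acc b ts x}
      = measure_pmf.prob D {t. run t x = Some b} ^ k" for b x
    unfolding acc_def by (rule prob_replicate_pmf_all)
  define \<theta> :: real where "\<theta> = 2 * (1/3) ^ k"
  \<comment> \<open>An answer is given only if exactly one of the two values receives a vote.
    Otherwise the output is \<open>None\<close>.\<close>
  define d where "d S v =
    (if votes \<tau> p \<theta> True S v \<noteq> votes \<tau> p \<theta> False S v then Some (votes \<tau> p \<theta> True S v) else None)"
    for S v
  let ?P = "random_subset {..<n} p"
  let ?v = "\<lambda>x S i. if i \<in> S then Some (x ! i) else None"
  have "measure_pmf.prob ?P {S. d S (?v x S) \<notin> {Some b, None}} \<le> \<epsilon> \<and>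
     (2/3 \<le> measure_pmf.prob D {t. run t x = Some b} \<longrightarrow>
       measure_pmf.prob ?P {S. d S (?v x S) \<noteq> Some b} \<le> 2 * \<epsilon>)"
    if x: "x \<in> strings A n" and robust: "\<And>w. w \<in> hamming_ball A n \<rho> x \<Longrightarrow>
      2/3 \<le> measure_pmf.prob D {t. run t w \<in> {Some b, None}}" for x b
  proof (intro conjI impI)
    have wrong: "measure_pmf.prob (replicate_pmf k D) {ts. acc (\<not> b) ts w} \<le> (1/3) ^ k"
      if "w \<in> hamming_ball A n \<rho> x" for w
    proof -
      have "{t. run t w = Some (\<not> b)} \<subseteq> UNIV - {t. run t w \<in> {Some b, None}}" by auto
      then have "measure_pmf.prob D {t. run t w = Some (\<not> b)}
          \<le> measure_pmf.prob D (UNIV - {t. run t w \<in> {Some b, None}})"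
        by (intro measure_pmf.finite_measure_mono) auto
      also have "\<dots> = 1 - measure_pmf.prob D {t. run t w \<in> {Some b, None}}"
        using measure_pmf.prob_compl[of "{t. run t w \<in> {Some b, None}}" D] by simp
      also have "\<dots> \<le> 1/3" using robust[OF that] by simp
      finally show ?thesis unfolding acc_prob by (intro power_mono) auto
    qed
    have vote_wrong: "measure_pmf.prob ?P {S. votes \<tau> p \<theta> (\<not> b) S (?v x S)} \<le> \<epsilon>"
      unfolding \<theta>_def
      by (rule prob_wrong_vote[where \<rho> = \<rho>])
        (use wrong A p x \<tau> small rare in \<open>auto simp only: intro: zero_le_power\<close>)
    have "{S. d S (?v x S) \<notin> {Some b, None}} \<subseteq> {S. votes \<tau> p \<theta> (\<not> b) S (?v x S)}"
      by (cases b) (auto simp: d_def)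
    then show "measure_pmf.prob ?P {S. d S (?v x S) \<notin> {Some b, None}} \<le> \<epsilon>"
      using vote_wrong measure_pmf.finite_measure_mono
      by (metis (no_types, lifting) UNIV_I order_trans sets_measure_pmf)
    assume right: "2/3 \<le> measure_pmf.prob D {t. run t x = Some b}"
    \<comment> \<open>The condition on \<open>k\<close> enters here: the ratio \<open>2 ^ k\<close>
      of \<open>(2/3) ^ k\<close> to \<open>(1/3) ^ k\<close> covers the \<open>k * l + 1\<close>
      levels and the factor 3 between \<open>\<sigma>\<close> and the share required on a
      level.\<close>
    have "real (Suc (k * l)) * (3 * (1/3) ^ k) = real (3 * (k * l + 1)) * (1/3) ^ k" by simp
    also have "\<dots> \<le> real (2 ^ k) * (1/3) ^ k"
      using k(2) by (intro mult_right_mono) (simp_all only: of_nat_le_iff, simp)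
    also have "\<dots> = (2/3) ^ k" by (simp add: power_divide)
    also have "\<dots> \<le> measure_pmf.prob (replicate_pmf k D) {ts. acc b ts x}"
      unfolding acc_prob using right by (intro power_mono) auto
    finally have vote_missing: "measure_pmf.prob ?P {S. \<not> votes \<tau> p \<theta> b S (?v x S)} \<le> \<epsilon>"
      unfolding \<theta>_def by (intro prob_missing_vote p x \<tau> rare) auto
    have "{S. d S (?v x S) \<noteq> Some b}
      \<subseteq> {S. votes \<tau> p \<theta> (\<not> b) S (?v x S)} \<union> {S. \<not> votes \<tau> p \<theta> b S (?v x S)}"
      by (cases b) (auto simp: d_def)
    then have "measure_pmf.prob ?P {S. d S (?v x S) \<noteq> Some b}
      \<le> measure_pmf.prob ?P ({S. votes \<tau> p \<theta> (\<not> b) S (?v x S)} \<union> {S. \<not> votes \<tau> p \<theta> b S (?v x S)})"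
      by (intro measure_pmf.finite_measure_mono) auto
    also have "\<dots> \<le> measure_pmf.prob ?P {S. votes \<tau> p \<theta> (\<not> b) S (?v x S)}
        + measure_pmf.prob ?P {S. \<not> votes \<tau> p \<theta> b S (?v x S)}"
      by (intro measure_Un_le) auto
    finally show "measure_pmf.prob ?P {S. d S (?v x S) \<noteq> Some b} \<le> 2 * \<epsilon>"
      using vote_wrong vote_missing by simp
  qed
  then show ?thesis by (intro exI[of _ d]) blast
qed

section \<open>The number of repetitions\<close>

text \<open>The choice is \<open>k = 6 * e\<close> with \<open>e\<close> the rounded-up logarithm of
  \<open>m\<close>. Then \<open>2 ^ k = 32 ^ e * 2 ^ e\<close>, where \<open>2 ^ e\<close> dominates
  \<open>l\<close> and \<open>32 ^ e\<close> dominates \<open>21 * e\<close>. Since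
  \<open>e \<le> 2 * log 2 m\<close>, one gets \<open>k * l + 1 \<le> 13 * m * log 2 m\<close>, and
  \<open>4 * 13\<^sup>2 = 676\<close> is below 1000. Taking the maximum with 2 keeps the logarithm
  at least 1.\<close>

lemma exists_repetitions:
  fixes l :: nat
  defines "m \<equiv> real (max 2 l)"
  shows "\<exists>k>0. 3 * (k * l + 1) \<le> (2::nat) ^ k \<and>
    4 * (real (k * l) + 1)\<^sup>2 < 1000 * m\<^sup>2 * (log 2 m)\<^sup>2"
proof -
  define e where "e = nat \<lceil>log 2 m\<rceil>"
  have m: "2 \<le> m" "real l \<le> m" by (auto simp: m_def)
  then have lg: "1 \<le> log 2 m" by simp
  then have e: "1 \<le> e" "log 2 m \<le> real e" "real e \<le> 2 * log 2 m" by (auto simp: e_def) linarith+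
  have "m \<le> 2 powr real e" using e(2) m by (simp add: log_le_iff)
  then have "m \<le> 2 ^ e" by (simp add: powr_realpow)
  with m(2) have "real l \<le> 2 ^ e" by linarith
  also have "(2::real) ^ e = real (2 ^ e)" by simp
  finally have l: "l \<le> 2 ^ e" by (simp only: of_nat_le_iff)
  have "21 * e \<le> (32::nat) ^ e"
    using e(1) by (induction e rule: dec_induct) auto
  have "3 * (6 * e * l + 1) \<le> 3 * (6 * e * 2 ^ e + 1)"
    using l by simp
  also have "\<dots> \<le> 21 * e * 2 ^ e"
    using mult_le_mono[of 1 e 1 "2 ^ e"] e(1) by simp
  also have "\<dots> \<le> 32 ^ e * 2 ^ e"
    using \<open>21 * e \<le> 32 ^ e\<close> by (rule mult_le_mono1)
  also have "\<dots> = (2::nat) ^ (6 * e)"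
    by (simp add: power_mult flip: power_mult_distrib)
  finally have 1: "3 * (6 * e * l + 1) \<le> (2::nat) ^ (6 * e)" .
  have "real (6 * e * l) + 1 \<le> 6 * (2 * log 2 m) * m + 1 * m * log 2 m"
  proof (intro add_mono)
    show "real (6 * e * l) \<le> 6 * (2 * log 2 m) * m"
      using e(3) m lg by (simp add: mult_mono)
    show "1 \<le> 1 * m * log 2 m" using m lg mult_mono[of 1 m 1 "log 2 m"] by simp
  qed
  then have "real (6 * e * l) + 1 \<le> 13 * (m * log 2 m)" by (simp add: algebra_simps)
  then have "(real (6 * e * l) + 1)\<^sup>2 \<le> (13 * (m * log 2 m))\<^sup>2" by (intro power_mono) auto
  also have "\<dots> = 169 * (m\<^sup>2 * (log 2 m)\<^sup>2)" by (simp add: power_mult_distrib)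
  finally have "4 * (real (6 * e * l) + 1)\<^sup>2 \<le> 676 * (m\<^sup>2 * (log 2 m)\<^sup>2)" by simp
  also have "\<dots> < 1000 * (m\<^sup>2 * (log 2 m)\<^sup>2)"
  proof -
    have "0 < m\<^sup>2 * (log 2 m)\<^sup>2" using m(1) lg by (intro mult_pos_pos zero_less_power) linarith+
    then show ?thesis by simp
  qed
  finally show ?thesis using 1 e(1) by (intro exI[of _ "6 * e"]) (simp add: mult.assoc)
qed

section \<open>Choice of the sampling probability\<close>

lemma eventually_le_powr:
  assumes "0 < (e::real)"
  shows "eventually (\<lambda>n. c \<le> real n powr e) sequentially"
proof -
  define K where "K = max c 1 powr (1 / e)"
  show ?thesis using eventually_ge_at_top[of "nat \<lceil>K\<rceil>"]
  proof eventually_elim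
    case (elim n)
    then have "K powr e \<le> real n powr e"
      using assms by (intro powr_mono2) (auto simp: K_def)
    moreover have "K powr e = max c 1" using assms by (simp add: K_def powr_powr)
    ultimately show ?case by simp
  qed
qed

text \<open>For \<open>j \<le> q\<close> the kernel bound grows like \<open>n\<close> to the power
  \<open>j / (q + 1)\<close>, which is sublinear. The last threshold, with index
  \<open>q + 1\<close>, only serves as a lower end of a level.\<close>

lemma eventually_level_small:
  fixes W \<rho> :: real
  assumes "0 < \<rho>" "j \<le> q"
  shows "eventually (\<lambda>n. W / real n powr (- (real j / (real q + 1))) \<le> \<rho> * real n) sequentially"
proof -
  define s where "s = real j / (real q + 1)"
  have "0 < 1 - s" using assms(2) by (simp add: s_def)
  from eventually_le_powr[OF this, of "W / \<rho>"] eventually_gt_at_top[of 0]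
  show ?thesis
  proof eventually_elim
    case (elim n)
    have "W * real n powr s \<le> (\<rho> * real n powr (1 - s)) * real n powr s"
      using elim assms by (intro mult_right_mono) (auto simp: field_simps)
    also have "\<dots> = \<rho> * real n" using elim by (simp add: mult.assoc flip: powr_add)
    finally show ?case by (simp add: powr_minus_divide flip: s_def)
  qed
qed

text \<open>Both exponents scale with the inverse threshold \<open>X\<close>, but the concentration
  term has the additional factor \<open>n powr g\<close>. Adjacent thresholds differ by the power
  \<open>1 / (q + 1)\<close> of \<open>n\<close>, and \<open>P n ^ (2 * q)\<close> loses less than
  half of it.\<close>

lemma eventually_level_rare:
  fixes a W \<sigma> \<epsilon> :: real and q :: nat
  assumes "0 \<le> a" "0 < W" "0 < \<sigma>" "0 < \<epsilon>"
  defines "Y \<equiv> \<lambda>n j::nat. real n powr (- (real j / (real q + 1)))"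
    and "P \<equiv> \<lambda>n. real n powr (- (1 / (4 * (real q + 1)\<^sup>2)))"
  shows "eventually (\<lambda>n. exp (a * (W / Y n j)) *
    exp (- 2 * \<sigma>\<^sup>2 * P n ^ (2 * q) / (Y n (Suc j) * W)) \<le> \<epsilon>) sequentially"
proof -
  \<comment> \<open>The power of \<open>n\<close> that remains from the gap between thresholds after
    paying for the sampling probability.\<close>
  define g where "g = 1 / (real q + 1) - real q / (2 * (real q + 1)\<^sup>2)"
  have "g = (real q + 2) / (2 * (real q + 1)\<^sup>2)"
    by (simp add: g_def divide_simps power2_eq_square)
  then have "0 < g" by simp
  \<comment> \<open>Truncation at 0 gives \<open>c \<le> X * c\<close>, so one bound on
    \<open>n\<close> absorbs \<open>\<epsilon>\<close> after multiplication by
    \<open>X\<close>.\<close>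
  define c where "c = max 0 (- ln \<epsilon>)"
  from eventually_le_powr[OF \<open>0 < g\<close>, of "(a * W + c) * W / (2 * \<sigma>\<^sup>2)"] eventually_gt_at_top[of 0]
  show ?thesis
  proof eventually_elim
    case (elim n)
    define X where "X = real n powr (real j / (real q + 1))"
    have X: "1 \<le> X" using elim by (simp add: X_def ge_one_powr_ge_zero)
    have "P n ^ (2 * q) = real n powr (- (real q / (2 * (real q + 1)\<^sup>2)))"
    proof -
      have "P n ^ (2 * q) = P n powr real (2 * q)"
        using elim by (subst powr_realpow) (simp_all add: P_def)
      also have "\<dots> = real n powr (- (1 / (4 * (real q + 1)\<^sup>2)) * real (2 * q))"
        unfolding P_def powr_powr ..
      also have "- (1 / (4 * (real q + 1)\<^sup>2)) * real (2 * q) = - (real q / (2 * (real q + 1)\<^sup>2))"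
        by simp
      finally show ?thesis .
    qed
    then have "P n ^ (2 * q) / Y n (Suc j)
        = real n powr (- (real q / (2 * (real q + 1)\<^sup>2)) + real (Suc j) / (real q + 1))"
      unfolding powr_add by (simp add: Y_def powr_minus_divide)
    also have "- (real q / (2 * (real q + 1)\<^sup>2)) + real (Suc j) / (real q + 1)
        = real j / (real q + 1) + g"
      by (simp add: g_def add_divide_distrib)
    finally have ratio: "P n ^ (2 * q) / Y n (Suc j) = X * real n powr g"
      by (simp add: X_def powr_add)
    have "(a * W + c) \<le> 2 * \<sigma>\<^sup>2 / W * real n powr g"
      using elim assms by (simp add: field_simps)
    then have "X * (a * W + c) \<le> X * (2 * \<sigma>\<^sup>2 / W * real n powr g)"
      using X by (intro mult_left_mono) auto
    moreover have "c \<le> X * c" using X mult_right_mono[of 1 X c] by (simp add: c_def)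
    ultimately have "a * W * X - 2 * \<sigma>\<^sup>2 / W * (X * real n powr g) \<le> - c"
      by (simp add: algebra_simps)
    also have "\<dots> \<le> ln \<epsilon>" by (simp add: c_def)
    finally have "exp (a * W * X - 2 * \<sigma>\<^sup>2 / W * (X * real n powr g)) \<le> \<epsilon>"
      using assms(4) by (metis exp_le_cancel_iff exp_ln)
    moreover have "a * (W / Y n j) = a * W * X" by (simp add: Y_def X_def powr_minus_divide)
    moreover have "- 2 * \<sigma>\<^sup>2 * P n ^ (2 * q) / (Y n (Suc j) * W)
        = - (2 * \<sigma>\<^sup>2 / W * (X * real n powr g))"
      unfolding ratio[symmetric] by simp
    ultimately show ?case by (simp flip: exp_add)
  qed
qed

text \<open>The strict inequality between \<open>E\<close> and \<open>D\<close> leaves the positive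
  power \<open>1 / E - 1 / D\<close> of \<open>n\<close> between expected sample size and
  cap.\<close>

lemma eventually_sample_cap:
  fixes D E :: real
  assumes "0 < E" "E < D" "0 < \<epsilon>"
  shows "eventually (\<lambda>n. real n powr (- (1 / E)) * real n / real n powr (1 - 1 / D) \<le> \<epsilon>) sequentially"
proof -
  define g where "g = 1 / E - 1 / D"
  have "0 < g" using assms by (simp add: g_def divide_simps)
  from eventually_le_powr[OF this, of "1 / \<epsilon>"] eventually_gt_at_top[of 0]
  show ?thesis
  proof eventually_elim
    case (elim n)
    have "real n powr (- (1 / E)) * real n / real n powr (1 - 1 / D)
        = real n powr (- (1 / E) + 1 - (1 - 1 / D))"
      using elim unfolding powr_diff powr_add by simp
    also have "- (1 / E) + 1 - (1 - 1 / D) = - g" by (simp add: g_def)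
    also have "real n powr \<dots> \<le> \<epsilon>"
      using elim assms by (simp add: powr_minus_divide divide_le_eq mult.commute)
    finally show ?case .
  qed
qed

section \<open>Assembly of the sample-based algorithm\<close>

text \<open>All conditions on \<open>n\<close> involve only \<open>card A\<close>, \<open>l\<close>
  and \<open>\<rho>\<close>. Hence one bound on \<open>n\<close> serves all \<open>Z\<close>,
  \<open>f\<close>, \<open>V\<close> and \<open>M\<close>.\<close>

lemma eventually_sample_based:
  fixes A :: "'s set" and l :: nat and \<rho> :: real
  assumes "finite A" "0 < \<rho>"
  defines "m \<equiv> real (max 2 l)"
  shows "eventually (\<lambda>n. \<forall>(Z :: 'z set) (f :: 'z \<times> 's list \<rightharpoonup> bool) (V :: 's list set)
        (M :: ('z, 's) algorithm) (\<rho>0 :: real) (\<rho>1 :: real).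
        dom f \<subseteq> Z \<times> strings A n \<longrightarrow> \<rho>0 \<ge> \<rho> \<longrightarrow> \<rho>1 \<ge> \<rho> \<longrightarrow>
        relaxed_local_algorithm A n Z f V (1/3) l M \<longrightarrow>
        robust A n f (1/3) M \<rho>0 \<rho>1 \<longrightarrow>
        (\<exists>(N :: ('z, 's) algorithm) q.
           sample_based n q N \<and>
           real q \<le> real n powr (1 - 1 / (1000 * m\<^sup>2 * (log 2 m)\<^sup>2)) \<and>
           relaxed_local_algorithm A n Z f V (1/3) q N)) sequentially"
proof -
  obtain k where k: "0 < k" "3 * (k * l + 1) \<le> (2::nat) ^ k"
    and E: "4 * (real (k * l) + 1)\<^sup>2 < 1000 * m\<^sup>2 * (log 2 m)\<^sup>2"
    using exists_repetitions[of l] unfolding m_def by blast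
  define W where "W = real k * real ((card A + 2) ^ l)"
  define \<tau> where "\<tau> n j = real n powr (- (real j / (real (k * l) + 1)))" for n j :: nat
  define p where "p n = real n powr (- (1 / (4 * (real (k * l) + 1)\<^sup>2)))" for n :: nat
  define D where "D = 1000 * m\<^sup>2 * (log 2 m)\<^sup>2"
  have "0 < W" using k by (simp add: W_def)
  have "eventually (\<lambda>n. \<forall>j\<in>{..k * l}. W / \<tau> n j \<le> \<rho> * real n) sequentially"
    unfolding \<tau>_def using assms(2)
    by (intro eventually_ball_finite ballI eventually_level_small) auto
  \<comment> \<open>The error budget: a wrong vote, a missing vote and an exceeded cap cost
    \<open>1/10\<close> each, together less than \<open>1/3\<close>.\<close>
  moreover have "eventually (\<lambda>n. \<forall>j\<in>{..k * l}. exp (real (card A) * (W / \<tau> n j)) *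
       exp (- 2 * ((1/3) ^ k)\<^sup>2 * p n ^ (2 * (k * l)) / (\<tau> n (Suc j) * W))
         \<le> (1/10) / real (Suc (k * l))) sequentially"
    unfolding \<tau>_def p_def using \<open>0 < W\<close>
    by (intro eventually_ball_finite ballI eventually_level_rare)
      (simp_all del: of_nat_mult add: of_nat_0_less_iff)
  moreover have "eventually (\<lambda>n. p n * real n / real n powr (1 - 1 / D) \<le> 1/10) sequentially"
    unfolding p_def D_def using E
    by (intro eventually_sample_cap) (simp_all add: add_nonneg_pos del: of_nat_mult)
  ultimately show ?thesis using eventually_gt_at_top[of 0]
  proof eventually_elim
    case (elim n)
    define P where "P = random_subset {..<n} (p n)"
    define q where "q = nat \<lfloor>real n powr (1 - 1 / D)\<rfloor>"
    have p: "0 < p n" "p n \<le> 1" using elim by (auto simp: p_def powr_minus_divide ge_one_powr_ge_zero divide_le_eq)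
    have \<tau>: "\<And>j. 0 < \<tau> n j" "decseq (\<tau> n)"
      using elim by (auto simp: \<tau>_def decseq_def intro!: powr_mono divide_right_mono)
    have cap: "measure_pmf.prob P {S. \<not> card S \<le> q} \<le> 1/10"
    proof -
      have "{S. \<not> card S \<le> q} \<subseteq> {S. real n powr (1 - 1 / D) \<le> real (card S)}"
        unfolding q_def by (auto simp: not_le) linarith
      then have "measure_pmf.prob P {S. \<not> card S \<le> q}
          \<le> measure_pmf.prob P {S. real n powr (1 - 1 / D) \<le> real (card S)}"
        by (intro measure_pmf.finite_measure_mono) auto
      also have "\<dots> \<le> p n * real (card {..<n}) / real n powr (1 - 1 / D)"
        unfolding P_def using p elim by (intro card_random_subset_tail) auto
      finally show ?thesis using elim(3) unfolding card_lessThan by linarith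
    qed
    show ?case
    proof (intro allI impI)
      fix Z :: "'z set" and f :: "'z \<times> 's list \<rightharpoonup> bool" and V :: "'s list set"
        and M :: "('z, 's) algorithm" and \<rho>0 \<rho>1 :: real
      assume dom: "dom f \<subseteq> Z \<times> strings A n" and \<rho>: "\<rho>0 \<ge> \<rho>" "\<rho>1 \<ge> \<rho>"
        and M: "relaxed_local_algorithm A n Z f V (1/3) l M"
        and rob: "robust A n f (1/3) M \<rho>0 \<rho>1"
      let ?v = "\<lambda>x S i. if i \<in> S then Some (x ! i) else None"
      define good where "good z d \<longleftrightarrow> (\<forall>x\<in>strings A n. \<forall>b.
        (\<forall>w\<in>hamming_ball A n \<rho> x. 2/3 \<le> measure_pmf.prob (M z) {t. run t w \<in> {Some b, None}}) \<longrightarrow>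
        measure_pmf.prob P {S. d S (?v x S) \<notin> {Some b, None}} \<le> 1/10 \<and>
        (2/3 \<le> measure_pmf.prob (M z) {t. run t x = Some b} \<longrightarrow>
          measure_pmf.prob P {S. d S (?v x S) \<noteq> Some b} \<le> 2 * (1/10)))"
        for z and d :: "nat set \<Rightarrow> (nat \<rightharpoonup> 's) \<Rightarrow> bool option"
      have "\<exists>d. good z d" if "z \<in> Z" for z
        unfolding good_def P_def
        using M elim that
        by (intro exists_sample_rule[where k = k and l = l and W = W and \<tau> = "\<tau> n"]
            assms(1) k p \<tau> W_def) (auto simp: relaxed_local_algorithm_def)
      \<comment> \<open>The rule is chosen separately for each \<open>z\<close>, while the sampling
        probability \<open>p n\<close> is common to all of them, as \<open>sample_based\<close>
        demands.\<close>
      then obtain d where good: "\<And>z. z \<in> Z \<Longrightarrow> good z (d z)" by metis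
      define T where "T z S = (if card S \<le> q then query_list (sorted_list_of_set S) Map.empty (d z S)
        else Output None)" for z S
      define N where "N z = map_pmf (T z) P" for z
      have "N z = bind_pmf (sample_set n (p n)) (\<lambda>S. if card S \<le> q
             then map_pmf (query_list (sorted_list_of_set S) Map.empty) (return_pmf (d z S))
             else return_pmf (Output None))" for z
        unfolding N_def T_def[abs_def] map_pmf_def sample_set_eq_random_subset P_def
        by (intro bind_pmf_cong) (auto simp: bind_return_pmf)
      then have sb: "sample_based n q N"
        unfolding sample_based_def using p by (intro exI[of _ "p n"] exI[of _ "\<lambda>z S. return_pmf (d z S)"]) auto
      have P_sub: "S \<subseteq> {..<n}" if "S \<in> set_pmf P" for S
        using that set_random_subset unfolding P_def by blast
      have run_T: "run (T z S) x = (if card S \<le> q then d z S (?v x S) else None)"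
        if "S \<in> set_pmf P" for z S x
        using P_sub[OF that] finite_subset[of S "{..<n}"] by (simp add: T_def run_query_list)
      have N_out: "1 - measure_pmf.prob P {S. run (T z S) x \<notin> B} \<le> output_prob N z x B" for z x B
      proof -
        have "output_prob N z x B = measure_pmf.prob P {S. run (T z S) x \<in> B}"
          by (simp add: output_prob_def N_def vimage_def)
        also have "{S. run (T z S) x \<in> B} = UNIV - {S. run (T z S) x \<notin> B}" by auto
        also have "measure_pmf.prob P \<dots> = 1 - measure_pmf.prob P {S. run (T z S) x \<notin> B}"
          using measure_pmf.prob_compl[of "{S. run (T z S) x \<notin> B}" P] by simp
        finally show ?thesis by simp
      qed
      have facts: "1 - 1/3 \<le> output_prob N z x {f (z, x), None}"
         "x \<in> V \<Longrightarrow> 1 - 1/3 \<le> output_prob N z x {f (z, x)}" if zx: "(z, x) \<in> dom f" for z x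
      proof -
        obtain b where b: "f (z, x) = Some b" using zx by auto
        have z: "z \<in> Z" and x: "x \<in> strings A n" using zx dom by auto
        have "2/3 \<le> measure_pmf.prob (M z) {t. run t w \<in> {Some b, None}}"
          if w: "w \<in> hamming_ball A n \<rho> x" for w
        proof -
          have "hamming_ball A n \<rho> x \<subseteq> hamming_ball A n \<rho>' x" if "\<rho> \<le> \<rho>'" for \<rho>'
            using mult_right_mono[OF that, of "real n"] by (auto simp: hamming_ball_def)
          then have "w \<in> hamming_ball A n \<rho>0 x" "w \<in> hamming_ball A n \<rho>1 x" using \<rho> w by auto
          then have "1 - 1/3 \<le> output_prob M z w {f (z, x), None}"
            using rob b unfolding robust_def robust_at_def by (metis (full_types))
          then show ?thesis by (simp add: output_prob_def b)
        qed
        with good[OF z] x have d: "measure_pmf.prob P {S. d z S (?v x S) \<notin> {Some b, None}} \<le> 1/10"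
          "2/3 \<le> measure_pmf.prob (M z) {t. run t x = Some b} \<Longrightarrow>
            measure_pmf.prob P {S. d z S (?v x S) \<noteq> Some b} \<le> 2 * (1/10)"
          unfolding good_def by blast+
        \<comment> \<open>An exceeded cap leads to the output \<open>None\<close>, which is
          permitted here. For valid inputs below it counts as an error.\<close>
        have "measure_pmf.prob P {S. run (T z S) x \<notin> {Some b, None}}
            \<le> measure_pmf.prob P {S. d z S (?v x S) \<notin> {Some b, None}}"
          using run_T by (intro measure_pmf.finite_measure_mono_AE) (auto simp: AE_measure_pmf_iff split: if_splits)
        then show "1 - 1/3 \<le> output_prob N z x {f (z, x), None}"
          using N_out[of z x "{f (z, x), None}"] d(1) unfolding b by linarith
        assume "x \<in> V"
        then have "1 - 1/3 \<le> output_prob M z x {f (z, x)}"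
          using M zx unfolding relaxed_local_algorithm_def by blast
        then have "2/3 \<le> measure_pmf.prob (M z) {t. run t x = Some b}"
          by (simp add: output_prob_def b)
        then have right: "measure_pmf.prob P {S. d z S (?v x S) \<noteq> Some b} \<le> 2 * (1/10)"
          by (rule d(2))
        have "measure_pmf.prob P {S. run (T z S) x \<notin> {Some b}}
            \<le> measure_pmf.prob P ({S. d z S (?v x S) \<noteq> Some b} \<union> {S. \<not> card S \<le> q})"
          using run_T by (intro measure_pmf.finite_measure_mono_AE) (auto simp: AE_measure_pmf_iff split: if_splits)
        also have "\<dots> \<le> measure_pmf.prob P {S. d z S (?v x S) \<noteq> Some b}
            + measure_pmf.prob P {S. \<not> card S \<le> q}"
          by (intro measure_Un_le) auto
        also have "\<dots> \<le> 1/3" using right cap by simp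
        finally show "1 - 1/3 \<le> output_prob N z x {f (z, x)}"
          using N_out[of z x "{f (z, x)}"] unfolding b by linarith
      qed
      have "queries_at_most A n t q" if "t \<in> set_pmf (N z)" for t z
      proof -
        obtain S where S: "S \<in> set_pmf P" "t = T z S" using \<open>t \<in> set_pmf (N z)\<close> by (auto simp: N_def)
        then show ?thesis
          using P_sub[OF S(1)] finite_subset[of S "{..<n}"]
          by (auto simp: T_def intro!: queries_at_most_query_list)
      qed
      then have "relaxed_local_algorithm A n Z f V (1/3) q N"
        using facts unfolding relaxed_local_algorithm_def by blast
      moreover have "real q \<le> real n powr (1 - 1 / D)" by (simp add: q_def)
      ultimately show "\<exists>(N :: ('z, 's) algorithm) q. sample_based n q N \<and>
           real q \<le> real n powr (1 - 1 / (1000 * m\<^sup>2 * (log 2 m)\<^sup>2)) \<and>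
           relaxed_local_algorithm A n Z f V (1/3) q N"
        using sb unfolding D_def by blast
    qed
  qed
qed

theorem theorem7p7:
  "\<exists>C>0. \<forall>(A :: 's set) (L :: nat) (\<rho> :: real). finite A \<longrightarrow> \<rho> > 0 \<longrightarrow>
     (\<exists>n0. \<forall>n\<ge>n0. \<forall>(Z :: 'z set) (f :: 'z \<times> 's list \<rightharpoonup> bool) (V :: 's list set)
        (M :: ('z, 's) algorithm) (l :: nat) (\<rho>0 :: real) (\<rho>1 :: real).
        dom f \<subseteq> Z \<times> strings A n \<longrightarrow>
        V \<subseteq> snd ` dom f \<longrightarrow>
        l \<le> L \<longrightarrow> \<rho>0 \<ge> \<rho> \<longrightarrow> \<rho>1 \<ge> \<rho> \<longrightarrow>
        relaxed_local_algorithm A n Z f V (1/3) l M \<longrightarrow>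
        robust A n f (1/3) M \<rho>0 \<rho>1 \<longrightarrow>
        (\<exists>(N :: ('z, 's) algorithm) q.
           sample_based n q N \<and>
           real q \<le> real n powr (1 - 1 / (C * (real (max 2 l))\<^sup>2 * (log 2 (real (max 2 l)))\<^sup>2)) \<and>
           relaxed_local_algorithm A n Z f V (1/3) q N))"
\<comment> \<open>The constant comes from \<open>exists_repetitions\<close> and depends on neither
  the alphabet nor \<open>L\<close> and \<open>\<rho>\<close>.\<close>
proof (rule exI[of _ 1000], intro conjI allI impI)
  fix A :: "'s set" and L :: nat and \<rho> :: real
  assume "finite A" "0 < \<rho>"
  \<comment> \<open>Only finitely many values \<open>l \<le> L\<close> occur, so their bounds on
    \<open>n\<close> combine into one \<open>n0\<close>.\<close>
  then have "eventually (\<lambda>n. \<forall>l\<in>{..L}. \<forall>(Z :: 'z set) (f :: 'z \<times> 's list \<rightharpoonup> bool) (V :: 's list set)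
        (M :: ('z, 's) algorithm) (\<rho>0 :: real) (\<rho>1 :: real).
        dom f \<subseteq> Z \<times> strings A n \<longrightarrow> \<rho>0 \<ge> \<rho> \<longrightarrow> \<rho>1 \<ge> \<rho> \<longrightarrow>
        relaxed_local_algorithm A n Z f V (1/3) l M \<longrightarrow>
        robust A n f (1/3) M \<rho>0 \<rho>1 \<longrightarrow>
        (\<exists>(N :: ('z, 's) algorithm) q.
           sample_based n q N \<and>
           real q \<le> real n powr (1 - 1 / (1000 * (real (max 2 l))\<^sup>2 * (log 2 (real (max 2 l)))\<^sup>2)) \<and>
           relaxed_local_algorithm A n Z f V (1/3) q N)) sequentially"
    by (intro eventually_ball_finite ballI eventually_sample_based) auto
  then obtain n0 where n0: "\<And>n l Z f V M \<rho>0 \<rho>1. n \<ge> n0 \<Longrightarrow> l \<le> L \<Longrightarrow>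
        dom f \<subseteq> Z \<times> strings A n \<Longrightarrow> \<rho>0 \<ge> \<rho> \<Longrightarrow> \<rho>1 \<ge> \<rho> \<Longrightarrow>
        relaxed_local_algorithm A n Z f V (1/3) l M \<Longrightarrow>
        robust A n f (1/3) (M :: ('z, 's) algorithm) \<rho>0 \<rho>1 \<Longrightarrow>
        (\<exists>(N :: ('z, 's) algorithm) q.
           sample_based n q N \<and>
           real q \<le> real n powr (1 - 1 / (1000 * (real (max 2 l))\<^sup>2 * (log 2 (real (max 2 l)))\<^sup>2)) \<and>
           relaxed_local_algorithm A n Z f V (1/3) q N)"
    unfolding eventually_sequentially by (metis atMost_iff)
  show "\<exists>n0. \<forall>n\<ge>n0. \<forall>(Z :: 'z set) (f :: 'z \<times> 's list \<rightharpoonup> bool) (V :: 's list set)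
        (M :: ('z, 's) algorithm) (l :: nat) (\<rho>0 :: real) (\<rho>1 :: real).
        dom f \<subseteq> Z \<times> strings A n \<longrightarrow>
        V \<subseteq> snd ` dom f \<longrightarrow>
        l \<le> L \<longrightarrow> \<rho>0 \<ge> \<rho> \<longrightarrow> \<rho>1 \<ge> \<rho> \<longrightarrow>
        relaxed_local_algorithm A n Z f V (1/3) l M \<longrightarrow>
        robust A n f (1/3) M \<rho>0 \<rho>1 \<longrightarrow>
        (\<exists>(N :: ('z, 's) algorithm) q.
           sample_based n q N \<and>
           real q \<le> real n powr (1 - 1 / (1000 * (real (max 2 l))\<^sup>2 * (log 2 (real (max 2 l)))\<^sup>2)) \<and>
           relaxed_local_algorithm A n Z f V (1/3) q N)"
    by (intro exI[of _ n0] allI impI n0)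
qed simp

end
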